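(* Let $(k_i)_{i\in\mathbb N}\subset\mathbb N$ be an eventually periodic (periodic or preperiodic) sequence such that $k_{2i}>1$ for infinitely many $i$ and $k_{2i-1}>1$ for infinitely many $i$. Then the corresponding interval translation map $(\Omega,T_{\alpha,\beta})$ is weakly mixing.
   Context: For $0<\beta\le\alpha\le 1$ let $T_{\alpha,\beta}:[0,1]\to[0,1]$ be $T_{\alpha,\beta}(x)=x+\alpha$ on $[0,1-\alpha)$, $x+\beta$ on $[1-\alpha,1-\beta)$, $x-1+\beta$ on $[1-\beta,1]$. Let $U=\{(\alpha,\beta):0<\beta\le\alpha\le 1\}$ and $G(\alpha,\beta)=\big(\beta/\alpha,\ (\beta-1)/\alpha+\lfloor 1/\alpha\rfloor\big)$. The map is of infinite type if $G^n(\alpha,\beta)$ lies in the interior of $U$ for all $n\ge0$; then $\Omega=\bigcap_{n\ge0}\overline{T^n_{\alpha,\beta}([0,1])}$ is a Cantor set on which $T_{\alpha,\beta}$ acts. Infinite type maps correspond bijectively to their coding sequences $k_i=\lfloor1/\alpha_i\rfloor$, $(\alpha_i,\beta_i)=G^{i-1}(\alpha,\beta)$, and these are exactly the sequences in $\mathbb N$ with $k_{2i}>1$ for infinitely many $i$ and $k_{2i-1}>1$ for infinitely many $i$. Weakly mixing means (with respect to the invariant probability measure, which is unique in this case) that the Koopman operator $f\mapsto f\circ T_{\alpha,\beta}$ has no eigenvalue other than $1$ and only constant eigenfunctions for eigenvalue $1$. *)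

theory Defs
  imports "HOL-Probability.Probability"
begin

definition itm :: "real \<Rightarrow> real \<Rightarrow> real \<Rightarrow> real" where
  "itm \<alpha> \<beta> x =
     (if x < 1 - \<alpha> then x + \<alpha>
      else if x < 1 - \<beta> then x + \<beta>
      else x - 1 + \<beta>)"

definition renorm :: "real \<times> real \<Rightarrow> real \<times> real" where
  "renorm p = (snd p / fst p, (snd p - 1) / fst p + of_int \<lfloor>1 / fst p\<rfloor>)"

text \<open>Interior of U = {(a,b). 0 < b <= a <= 1}.\<close>
definition in_int_U :: "real \<times> real \<Rightarrow> bool" where
  "in_int_U p \<longleftrightarrow> 0 < snd p \<and> snd p < fst p \<and> fst p < 1"

definition infinite_type :: "real \<Rightarrow> real \<Rightarrow> bool" where
  "infinite_type \<alpha> \<beta> \<longleftrightarrow> (\<forall>n. in_int_U ((renorm ^^ n) (\<alpha>, \<beta>)))"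

text \<open>Coding sequence k_i = floor(1/alpha_i), (alpha_i,beta_i) = G^(i-1)(alpha,beta), i >= 1.\<close>
definition coding :: "real \<Rightarrow> real \<Rightarrow> nat \<Rightarrow> nat" where
  "coding \<alpha> \<beta> i = nat \<lfloor>1 / fst ((renorm ^^ (i - 1)) (\<alpha>, \<beta>))\<rfloor>"

definition attractor :: "real \<Rightarrow> real \<Rightarrow> real set" where
  "attractor \<alpha> \<beta> = (\<Inter>n. closure ((itm \<alpha> \<beta> ^^ n) ` {0..1}))"

definition eventually_periodic :: "(nat \<Rightarrow> nat) \<Rightarrow> bool" where
  "eventually_periodic k \<longleftrightarrow> (\<exists>p>0. \<exists>N. \<forall>i\<ge>N. k (i + p) = k i)"

definition invariant_prob :: "real \<Rightarrow> real \<Rightarrow> real measure \<Rightarrow> bool" where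
  "invariant_prob \<alpha> \<beta> \<mu> \<longleftrightarrow>
     prob_space \<mu> \<and> sets \<mu> = sets (restrict_space borel (attractor \<alpha> \<beta>)) \<and>
     itm \<alpha> \<beta> \<in> measurable \<mu> \<mu> \<and> distr \<mu> \<mu> (itm \<alpha> \<beta>) = \<mu>"

definition weakly_mixing :: "(real \<Rightarrow> real) \<Rightarrow> real measure \<Rightarrow> bool" where
  "weakly_mixing T \<mu> \<longleftrightarrow>
     (\<forall>(f :: real \<Rightarrow> complex) (c :: complex).
        f \<in> borel_measurable \<mu> \<and> integrable \<mu> (\<lambda>x. (cmod (f x))\<^sup>2) \<and>
        (AE x in \<mu>. f (T x) = c * f x) \<and> \<not> (AE x in \<mu>. f x = 0)
        \<longrightarrow> c = 1 \<and> (\<exists>z. AE x in \<mu>. f x = z))"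

end

theory Submission
  imports Defs
begin

text \<open>
  Renormalising \<open>n\<close> times rescales \<open>T\<close> to its first return map to an interval \<open>J n\<close> ending at 1; the
  return times and the lengths of the \<open>J n\<close> satisfy one unimodular third-order recurrence, and the
  measures \<open>\<mu> (J n)\<close> satisfy the dual one. Both are tied together by a bilinear pairing that is
  constant in \<open>n\<close>. Three facts about these sequences do the work. Every dual sequence orthogonal to
  the lengths tends to 0 (a Lyapunov argument), so an integral one vanishes and 1, \<open>\<alpha>\<close>, \<open>\<beta>\<close> are
  rationally independent; this excludes periodic points and makes a weak limit of orbit averages
  invariant. By the same decay, every solution of the recurrence tending to 0 is a multiple of the
  lengths. And the ratios \<open>\<mu> (J (n + 1)) / \<mu> (J n)\<close> are forced by a projective contraction, which
  gives unique ergodicity.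

  If \<open>c = exp (2 \<pi> \<i> \<theta>)\<close> is an eigenvalue, then approximating the eigenfunction by a continuous one on
  towers of mass bounded below yields \<open>c ^ h \<longlonglongrightarrow> 1\<close> along the return times \<open>h\<close>. So the distances of
  \<open>\<theta> h\<close> to the integers form a multiple of the lengths, with an integer factor, and independence
  of 1, \<open>\<alpha>\<close>, \<open>\<beta>\<close> makes this factor 0 and \<open>\<theta>\<close> an integer.
\<close>

section \<open>Renormalisation and first returns\<close>

text \<open>Eventual periodicity enters through two uniform bounds: all digits are at most
  \<open>K\<close>, and among any \<open>G + 1\<close> indices in steps of two some digit is at
  least 2. The steps of two are forced: where a digit is 1, \<open>1 - a n\<close> is comparable
  only to \<open>1 - a (n + 2)\<close>, and the measures behave alike, so lower bounds travel within
  one parity class. These bounds make the decay rate, the projective contraction and the tower mass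
  independent of the level. Asymptotic statements become exact relations because integers tending to
  0 are eventually 0, and because a recurrence whose earliest term has coefficient -1 can be run
  backwards in the integers. Existence of the measure needs an argument of its own: \<open>T\<close>
  is discontinuous and the attractor is an intersection of closures, so neither the invariance of a
  weak limit nor that of the attractor is automatic at the break points \<open>1 - \<alpha>\<close>
  and \<open>1 - \<beta>\<close>.\<close>

locale infinite_type_itm =
  fixes \<alpha> \<beta> :: real
  assumes inf: "infinite_type \<alpha> \<beta>"
begin

abbreviation (input) "T \<equiv> itm \<alpha> \<beta>"

text \<open>Indices start at 0: \<open>digit n\<close> is the paper's \<open>k\<close> with index \<open>n + 1\<close>.\<close>

definition a :: "nat \<Rightarrow> real" where "a n = fst ((renorm ^^ n) (\<alpha>, \<beta>))"
definition b :: "nat \<Rightarrow> real" where "b n = snd ((renorm ^^ n) (\<alpha>, \<beta>))"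
definition digit :: "nat \<Rightarrow> nat" where "digit n = nat \<lfloor>1 / a n\<rfloor>"
definition len :: "nat \<Rightarrow> real" where "len n = (\<Prod>i<n. a i)"

lemma a_0: "a 0 = \<alpha>" and b_0: "b 0 = \<beta>"
  by (simp_all add: a_def b_def)

lemma b_pos: "0 < b n" and b_less_a: "b n < a n" and a_less_1: "a n < 1"
  using inf by (auto simp: infinite_type_def in_int_U_def a_def b_def)

lemma a_pos: "0 < a n"
  using b_pos b_less_a by (rule less_trans)

lemma a_nz [simp]: "a n \<noteq> 0"
  using a_pos[of n] by simp

lemma digit_eq_floor: "real (digit n) = of_int \<lfloor>1 / a n\<rfloor>"
  using a_pos[of n] by (simp add: digit_def of_nat_nat)

lemma digit_ge_1: "1 \<le> digit n"
proof -
  have "1 \<le> 1 / a n" using a_pos[of n] a_less_1[of n] by simp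
  then have "1 \<le> \<lfloor>1 / a n\<rfloor>" by (simp add: le_floor_iff)
  then show ?thesis unfolding digit_def by linarith
qed

lemma a_Suc: "a (Suc n) = b n / a n"
  and b_Suc: "b (Suc n) = (b n - 1) / a n + digit n"
  by (simp_all add: digit_eq_floor) (simp_all add: a_def b_def renorm_def)

lemma b_eq: "b n = a n * a (Suc n)"
  by (simp add: a_Suc)

lemma digit_recurrence: "1 / a n = digit n + a (Suc n) - b (Suc n)"
  unfolding b_Suc a_Suc by (simp add: field_simps)

lemma a_ge: "1 / (real (digit n) + 1) \<le> a n"
proof -
  have "1 / a n \<le> real (digit n) + 1" unfolding digit_eq_floor by linarith
  then show ?thesis using a_pos[of n] by (simp add: field_simps)
qed

lemma a_le_half: "2 \<le> digit n \<Longrightarrow> a n \<le> 1 / 2"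
proof -
  assume "2 \<le> digit n"
  then have "2 \<le> 1 / a n" using digit_eq_floor[of n] by linarith
  then show ?thesis using a_pos[of n] by (simp add: field_simps)
qed

lemma one_minus_a: "digit n = 1 \<Longrightarrow> 1 - a n = a n * a (Suc n) * (1 - a (n + 2))"
  using digit_recurrence[of n] b_eq[of "Suc n"] by (simp add: field_simps)

lemma len_0 [simp]: "len 0 = 1" and len_Suc: "len (Suc n) = len n * a n"
  by (simp_all add: len_def)

lemma len_1: "len (Suc 0) = \<alpha>" and len_2: "len 2 = \<beta>"
  using b_eq[of 0] by (simp_all add: len_Suc a_0 b_0 numeral_2_eq_2)

lemma len_pos: "0 < len n"
  by (simp add: len_def prod_pos a_pos)

lemma len_less: "len (Suc n) < len n"
  using len_pos[of n] a_less_1[of n] by (simp add: len_Suc)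

lemma len_antimono: "m \<le> n \<Longrightarrow> len n \<le> len m"
  using lift_Suc_antimono_le[of len] len_less less_imp_le by blast

lemma len_rec: "len (n + 3) = len (n + 2) + digit n * len (n + 1) - len n"
proof -
  have "a n * b (Suc n) = b n - 1 + digit n * a n"
    unfolding b_Suc by (simp add: field_simps)
  then have "a n * (a (Suc n) * a (Suc (Suc n))) = a n * a (Suc n) - 1 + digit n * a n"
    by (simp only: b_eq)
  then have "len n * (a n * (a (Suc n) * a (Suc (Suc n)))) = len n * (a n * a (Suc n) - 1 + digit n * a n)"
    by simp
  then show ?thesis by (simp add: len_Suc eval_nat_numeral algebra_simps)
qed

text \<open>The first return time to \<open>J n\<close> is \<open>ht (n + 1)\<close> on \<open>D n\<close>, \<open>ht (n + 2)\<close> on \<open>D (n + 1)\<close> and \<open>hs n\<close> on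
  \<open>J (n + 2)\<close>. The subtractions do not truncate.\<close>

fun ht :: "nat \<Rightarrow> nat" where
  "ht 0 = 0"
| "ht (Suc 0) = 1"
| "ht (Suc (Suc 0)) = 1"
| "ht (Suc (Suc (Suc n))) = ht (Suc (Suc n)) + digit n * ht (Suc n) - ht n"

lemma ht_mono_Suc: "ht n \<le> ht (Suc n)"
proof (induction n rule: ht.induct)
  case (4 n)
  then have "ht (Suc n) \<le> ht (Suc (Suc n))" "ht n \<le> ht (Suc n)" by simp_all
  moreover have "ht (Suc (Suc n)) \<le> digit (Suc n) * ht (Suc (Suc n))" using digit_ge_1[of "Suc n"] by simp
  moreover have "ht (Suc n) \<le> digit n * ht (Suc n)" using digit_ge_1[of n] by simp
  ultimately show ?case unfolding ht.simps by linarith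
qed (use digit_ge_1[of 0] in auto)

lemma ht_mono: "m \<le> n \<Longrightarrow> ht m \<le> ht n"
  using lift_Suc_mono_le[of ht] ht_mono_Suc by blast

lemma ht_pos: "0 < n \<Longrightarrow> 0 < ht n"
  using ht_mono[of 1 n] by simp

lemma ht_rec: "ht (n + 3) + ht n = ht (n + 2) + digit n * ht (n + 1)"
proof -
  have "ht n \<le> ht (n + 2)" by (intro ht_mono) simp
  then show ?thesis by (simp add: eval_nat_numeral)
qed

definition hs :: "nat \<Rightarrow> nat" where "hs n = ht (n + 2) - ht n"

lemma hs_eq: "hs n + ht n = ht (n + 2)"
  unfolding hs_def using ht_mono[of n "n + 2"] by simp

text \<open>The recurrence of \<open>ht\<close> with nonnegative terms, which makes
  \<open>hs\<close> monotone. It also counts the last branch in \<open>first_return\<close>: one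
  passage through \<open>J (n + 2)\<close>, then \<open>digit n - 1\<close> passages through
  \<open>D n\<close>.\<close>

lemma hs_Suc: "hs (Suc n) = hs n + (digit n - 1) * ht (Suc n)"
proof -
  obtain m where "digit n = Suc m" using digit_ge_1[of n] by (cases "digit n") auto
  then show ?thesis using hs_eq[of n] hs_eq[of "Suc n"] ht_rec[of n]
    by (simp add: eval_nat_numeral)
qed

lemma hs_mono: "m \<le> n \<Longrightarrow> hs m \<le> hs n"
  by (rule lift_Suc_mono_le[of hs]) (simp_all add: hs_Suc)

lemma hs_pos: "0 < hs n"
  using hs_mono[of 0 n] by (simp add: hs_def)

lemma ht_eq_hs: "ht (n + 3) = hs n + digit n * ht (n + 1)"
  using ht_rec[of n] hs_eq[of n] by simp

section \<open>The nested intervals and first returns to them\<close>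

definition J :: "nat \<Rightarrow> real set" where "J n = {1 - len n..1}"
definition D :: "nat \<Rightarrow> real set" where "D n = {1 - len n..<1 - len (Suc n)}"

lemma J_0: "J 0 = {0..1}" by (simp add: J_def)

lemma J_Suc: "J n = D n \<union> J (Suc n)" and D_J_disjoint: "D n \<inter> J (Suc n) = {}"
  using len_less[of n] len_pos[of "Suc n"] by (auto simp: J_def D_def)

lemma J_antimono: "m \<le> n \<Longrightarrow> J n \<subseteq> J m"
  using len_antimono[of m n] by (auto simp: J_def)

text \<open>Landing in \<open>X\<close> at time \<open>h\<close> is not demanded, because partial
  itineraries that are still outside \<open>X\<close> have to be composed. The last clause says that
  all iterates up to time \<open>h\<close> move \<open>E\<close> rigidly.\<close>

definition returns :: "real set \<Rightarrow> real set \<Rightarrow> nat \<Rightarrow> real \<Rightarrow> bool" where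
  "returns X E h v \<longleftrightarrow>
     (\<forall>x\<in>E. (T ^^ h) x = x + v \<and> (\<forall>i. 0 < i \<and> i < h \<longrightarrow> (T ^^ i) x \<notin> X) \<and>
        (\<forall>y\<in>E. \<forall>i\<le>h. (T ^^ i) x - (T ^^ i) y = x - y))"

lemma returns_mono: "returns X E h v \<Longrightarrow> Y \<subseteq> X \<Longrightarrow> F \<subseteq> E \<Longrightarrow> returns Y F h v"
  unfolding returns_def by blast

lemma returns_1: "(\<And>x. x \<in> E \<Longrightarrow> T x = x + v) \<Longrightarrow> returns X E 1 v"
  by (auto simp: returns_def le_Suc_eq)

text \<open>Time \<open>h\<close> becomes an intermediate time of the longer itinerary, hence the
  requirement that \<open>x + v\<close> avoid \<open>X\<close>.\<close>

lemma returns_comp: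
  assumes 1: "returns X E h v" and 2: "returns X E' h' v'"
    and E': "\<And>x. x \<in> E \<Longrightarrow> x + v \<in> E' - X"
  shows "returns X E (h + h') (v + v')"
  unfolding returns_def
proof (intro ballI conjI allI impI; (elim conjE)?)
  fix x assume x: "x \<in> E"
  have v: "(T ^^ h) z = z + v" if "z \<in> E" for z using 1 that by (auto simp: returns_def)
  have later: "(T ^^ (h + j)) z = (T ^^ j) (z + v)" if "z \<in> E" for z j
    using v[OF that] by (simp add: add.commute[of h] funpow_add)
  show "(T ^^ (h + h')) x = x + (v + v')"
    using later[OF x, of h'] 2 E'[OF x] by (simp add: returns_def)
  fix i assume i: "0 < i" "i < h + h'"
  show "(T ^^ i) x \<notin> X"
  proof (cases "i < h")
    case True then show ?thesis using 1 x i by (auto simp: returns_def)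
  next
    case False
    then obtain j where j: "i = h + j" by (metis le_Suc_ex not_less)
    show ?thesis
      using later[OF x, of j] 2 E'[OF x] i j by (cases "j = 0") (auto simp: returns_def)
  qed
next
  fix x y i assume x: "x \<in> E" and y: "y \<in> E" and i: "i \<le> h + h'"
  have v: "(T ^^ h) z = z + v" if "z \<in> E" for z using 1 that by (auto simp: returns_def)
  have later: "(T ^^ (h + j)) z = (T ^^ j) (z + v)" if "z \<in> E" for z j
    using v[OF that] by (simp add: add.commute[of h] funpow_add)
  show "(T ^^ i) x - (T ^^ i) y = x - y"
  proof (cases "i \<le> h")
    case True then show ?thesis using 1 x y by (auto simp: returns_def)
  next
    case False
    then obtain j where j: "i = h + j" by (metis le_Suc_ex nat_le_linear)
    have "(T ^^ j) (x + v) - (T ^^ j) (y + v) = (x + v) - (y + v)"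
      using 2 E'[OF x] E'[OF y] i j unfolding returns_def by (metis DiffD1 add_le_cancel_left)
    then show ?thesis using later[OF x, of j] later[OF y, of j] j by simp
  qed
qed

lemma returns_iterate:
  assumes "returns X E h v" "returns X E' h' v'"
    and "\<And>x j. x \<in> E \<Longrightarrow> j < m \<Longrightarrow> x + (v + real j * v') \<in> E' - X"
  shows "returns X E (h + m * h') (v + m * v')"
  using assms(3)
proof (induction m)
  case 0 then show ?case using assms(1) by simp
next
  case (Suc m)
  have "returns X E (h + m * h' + h') (v + m * v' + v')"
    by (rule returns_comp[OF Suc.IH assms(2)]) (use Suc.prems in \<open>auto simp: add_ac\<close>)
  then show ?case by (simp add: algebra_simps)
qed

text \<open>Passing from \<open>J n\<close> to \<open>J (n + 1)\<close> keeps the branch on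
  \<open>D (n + 1)\<close>, whereas \<open>J (n + 2)\<close> is sent to the left end of
  \<open>J n\<close> and has to be carried right in steps of \<open>len (n + 1)\<close> until it
  meets \<open>J (n + 1)\<close>. By \<open>len_rec\<close> this takes \<open>digit n\<close> steps
  from \<open>D (n + 2)\<close> and one fewer from \<open>J (n + 3)\<close>, which creates the new
  break point.\<close>

lemma first_return:
  shows "returns (J n) (D n) (ht (n + 1)) (len (n + 1)) \<and>
    returns (J n) (D (n + 1)) (ht (n + 2)) (len (n + 2)) \<and>
    returns (J n) (J (n + 2)) (hs n) (len (n + 2) - len n)"
proof (induction n)
  case 0
  have "hs 0 = 1" by (simp add: hs_def eval_nat_numeral)
  moreover have "\<beta> < \<alpha>" using b_less_a[of 0] by (simp add: a_0 b_0)
  moreover have "len 1 = \<alpha>" using len_1 by simp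
  moreover have "ht 1 = 1" "ht 2 = 1" by (simp_all add: eval_nat_numeral)
  moreover have "returns (J 0) (D 0) 1 \<alpha>" "returns (J 0) (D 1) 1 \<beta>" "returns (J 0) (J 2) 1 (\<beta> - 1)"
    using len_1 len_2 \<open>\<beta> < \<alpha>\<close>
    by (auto intro!: returns_1[unfolded One_nat_def] simp: D_def J_def itm_def numeral_2_eq_2)
  ultimately show ?case
    using len_2 by (simp add: numeral_2_eq_2)
next
  case (Suc n)
  have ret: "returns (J (Suc n)) E h v" if "returns (J n) E h v" for E h v
    by (rule returns_mono[OF that J_antimono]) simp_all
  have D: "returns (J (Suc n)) (D n) (ht (n + 1)) (len (n + 1))"
    and J: "returns (J (Suc n)) (J (n + 2)) (hs n) (len (n + 2) - len n)"
    using Suc ret by blast+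
  note rec = len_rec[of n]
  have pos: "0 < len (n + 1)" "0 < len (n+3)" "len (n + 3) < len (n + 2)" "len (n + 2) < len (n + 1)" "len (n+1) < len n"
    using len_pos len_less by (simp_all add: eval_nat_numeral)
  have DJ: "D (n + 2) \<subseteq> J (n + 2)" "J (n + 3) \<subseteq> J (n + 2)" using J_Suc[of "n + 2"] by (auto simp: eval_nat_numeral)
  have 2: "returns (J (Suc n)) (D (n + 2)) (hs n + digit n * ht (n + 1)) (len (n + 2) - len n + digit n * len (n + 1))"
  proof (rule returns_iterate[OF returns_mono[OF J order_refl DJ(1)] D])
    fix x j assume x: "x \<in> D (n + 2)" and j: "j < digit n"
    have "real j * len (n+1) \<le> (real (digit n) - 1) * len (n+1)"
      by (rule mult_right_mono) (use j pos in auto)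
    then have "real j * len (n+1) \<le> real (digit n) * len (n+1) - len (n+1)"
      by (simp add: algebra_simps)
    moreover have "0 \<le> real j * len (n+1)" using less_imp_le[OF pos(1)] by simp
    moreover have "1 - len (n + 2) \<le> x" "x < 1 - len (n + 3)" using x pos by (simp_all add: D_def eval_nat_numeral)
    ultimately have "1 - len n \<le> x + (len (n + 2) - len n + real j * len (n + 1))"
      "x + (len (n + 2) - len n + real j * len (n + 1)) < 1 - len (n + 1)"
      using rec pos by linarith+
    then show "x + (len (n + 2) - len n + real j * len (n + 1)) \<in> D n - J (Suc n)"
      by (simp add: D_def J_def)
  qed
  have 3: "returns (J (Suc n)) (J (n + 3)) (hs n + (digit n - 1) * ht (n + 1)) (len (n + 2) - len n + real (digit n - 1) * len (n + 1))"
  proof (rule returns_iterate[OF returns_mono[OF J order_refl DJ(2)] D])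
    fix x j assume x: "x \<in> J (n + 3)" and j: "j < digit n - 1"
    have "real j * len (n+1) \<le> (real (digit n) - 2) * len (n+1)"
      by (rule mult_right_mono) (use j pos in auto)
    then have "real j * len (n+1) \<le> real (digit n) * len (n+1) - 2 * len (n+1)"
      by (simp add: algebra_simps)
    moreover have "0 \<le> real j * len (n+1)" using less_imp_le[OF pos(1)] by simp
    moreover have "1 - len (n + 2) \<le> x" "x \<le> 1" using x pos by (auto simp: D_def J_def)
    ultimately have "1 - len n \<le> x + (len (n + 2) - len n + real j * len (n + 1))"
      "x + (len (n + 2) - len n + real j * len (n + 1)) < 1 - len (n + 1)"
      using rec pos by linarith+
    then show "x + (len (n + 2) - len n + real j * len (n + 1)) \<in> D n - J (Suc n)"
      by (simp add: D_def J_def)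
  qed
  have e: "hs n + (digit n - 1) * ht (n + 1) = hs (Suc n)" by (simp add: hs_Suc)
  have e': "len (n + 2) - len n + real (digit n - 1) * len (n + 1) = len (Suc n + 2) - len (Suc n)"
    using rec digit_ge_1[of n] by (simp add: of_nat_diff algebra_simps eval_nat_numeral)
  have e'': "len (n + 2) - len n + digit n * len (n + 1) = len (Suc n + 2)"
    using rec by (simp add: eval_nat_numeral)
  have i: "ht (Suc n + 2) = hs n + digit n * ht (n + 1)" using ht_eq_hs[of n] by (simp add: eval_nat_numeral)
  have "returns (J (Suc n)) (D (Suc n)) (ht (Suc n + 1)) (len (Suc n + 1))"
    using ret[OF Suc[THEN conjunct2, THEN conjunct1]] by simp
  moreover have "returns (J (Suc n)) (D (Suc n + 1)) (ht (Suc n + 2)) (len (Suc n + 2))"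
    using 2 unfolding e'' i by simp
  moreover have "returns (J (Suc n)) (J (Suc n + 2)) (hs (Suc n)) (len (Suc n + 2) - len (Suc n))"
    using 3 unfolding e e' by (simp add: numeral_3_eq_3)
  ultimately show ?case by blast
qed

lemmas returns_D = first_return[THEN conjunct1]
  and returns_D_Suc = first_return[THEN conjunct2, THEN conjunct1]
  and returns_J = first_return[THEN conjunct2, THEN conjunct2]

text \<open>On \<open>D n\<close> the return map moves right by the fixed amount
  \<open>len (n + 1)\<close>, so the waiting time is bounded uniformly in the point.
  \<open>tower_partition\<close> needs this common bound.\<close>

lemma enters_J: "\<exists>N. \<forall>x\<in>{0..1}. \<exists>i\<le>N. (T ^^ i) x \<in> J n"
proof (induction n)
  case 0 then show ?case by (auto simp: J_0 intro!: exI[of _ 0])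
next
  case (Suc n)
  then obtain N where N: "\<And>x. x \<in> {0..1} \<Longrightarrow> \<exists>i\<le>N. (T ^^ i) x \<in> J n" by blast
  have step: "\<exists>i\<le>m * ht (n + 1). (T ^^ i) y \<in> J (Suc n)"
    if "y \<in> J n" "1 - (real m + 1) * len (n + 1) \<le> y" for y m
    using that
  proof (induction m arbitrary: y)
    case 0 then show ?case by (auto simp: J_def)
  next
    case (Suc m)
    show ?case
    proof (cases "y \<in> J (Suc n)")
      case False
      then have D: "y \<in> D n" using Suc.prems J_Suc by blast
      then have y: "(T ^^ ht (n + 1)) y = y + len (n + 1)" using returns_D[of n] by (auto simp: returns_def)
      have "\<exists>i\<le>m * ht (n + 1). (T ^^ i) (y + len (n + 1)) \<in> J (Suc n)"
        by (rule Suc.IH) (use Suc.prems D len_pos[of "n+1"] in \<open>auto simp: J_def D_def algebra_simps\<close>)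
      then obtain i where "i \<le> m * ht (n + 1)" "(T ^^ (i + ht (n + 1))) y \<in> J (Suc n)"
        using y by (auto simp: funpow_add)
      then show ?thesis by (intro exI[of _ "i + ht (n + 1)"]) simp
    qed (auto intro: exI[of _ 0])
  qed
  obtain m where "len n / len (n + 1) \<le> real m" using real_arch_simple by blast
  then have m: "len n \<le> (real m + 1) * len (n + 1)" using len_pos[of "n + 1"] by (simp add: field_simps)
  have "\<exists>i\<le>N + m * ht (n + 1). (T ^^ i) x \<in> J (Suc n)" if x: "x \<in> {0..1}" for x
  proof -
    obtain i where i: "i \<le> N" "(T ^^ i) x \<in> J n" using N[OF x] by blast
    obtain j where "j \<le> m * ht (n + 1)" "(T ^^ j) ((T ^^ i) x) \<in> J (Suc n)"
      using step[OF i(2), of m] m i(2) by (auto simp: J_def)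
    then show ?thesis using i by (intro exI[of _ "j + i"]) (auto simp: funpow_add)
  qed
  then show ?case by blast
qed

lemma itm_in: "x \<in> {0..1} \<Longrightarrow> T x \<in> {0..1}"
  using b_pos[of 0] b_less_a[of 0] a_less_1[of 0] by (auto simp: itm_def a_0 b_0)

lemma funpow_itm_in: "x \<in> {0..1} \<Longrightarrow> (T ^^ n) x \<in> {0..1}"
  by (induction n) (simp_all add: itm_in del: atLeastAtMost_iff)

end

section \<open>The recurrence and its dual\<close>

locale bounded_type_itm = infinite_type_itm +
  fixes K G :: nat
  assumes digit_le: "digit n \<le> K"
    and gap: "\<exists>j\<le>G. 2 \<le> digit (n + 2 * j)"
begin

lemma a_lower: "1 / (real K + 1) \<le> a n"
proof -
  have "1 / (real K + 1) \<le> 1 / (real (digit n) + 1)"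
    using digit_le[of n] by (simp add: frac_le)
  then show ?thesis using a_ge[of n] by linarith
qed

text \<open>\<open>a n\<close> can be close to 1 only where \<open>digit n = 1\<close>. There
  \<open>one_minus_a\<close> loses at most the factor \<open>q\<close> in passing to
  \<open>n + 2\<close>, and by \<open>gap\<close> at most \<open>G\<close> such passages lead to an
  index where \<open>a_le_half\<close> applies.\<close>

lemma one_minus_a_lower: "\<exists>\<eta>>0. \<forall>n. \<eta> \<le> 1 - a n"
proof -
  define q where "q = (1 / (real K + 1))\<^sup>2"
  have q: "0 < q" "q \<le> 1" by (auto simp: q_def power_le_one)
  have claim: "q ^ j / 2 \<le> 1 - a n" if "2 \<le> digit (n + 2 * j)" for j n
    using that
  proof (induction j arbitrary: n)
    case 0 then show ?case using a_le_half[of n] by simp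
  next
    case (Suc j)
    show ?case
    proof (cases "2 \<le> digit n")
      case True
      have "q ^ Suc j \<le> 1" using q by (intro power_le_one) auto
      then show ?thesis using a_le_half[OF True] by linarith
    next
      case False
      then have d: "digit n = 1" using digit_ge_1[of n] by simp
      have "q * (q ^ j / 2) \<le> (a n * a (Suc n)) * (1 - a (n + 2))"
      proof (rule mult_mono)
        show "q \<le> a n * a (Suc n)" unfolding q_def power2_eq_square
          by (intro mult_mono a_lower) (auto intro: less_imp_le a_pos)
        show "q ^ j / 2 \<le> 1 - a (n + 2)" by (rule Suc.IH) (use Suc.prems in simp)
      qed (use q in \<open>auto intro!: less_imp_le mult_pos_pos a_pos\<close>)
      then show ?thesis using one_minus_a[OF d] by simp
    qed
  qed
  show ?thesis
  proof (intro exI[of _ "q ^ G / 2"] conjI allI)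
    fix n
    obtain j where j: "j \<le> G" "2 \<le> digit (n + 2 * j)" using gap by blast
    have "q ^ G \<le> q ^ j" using q j(1) by (intro power_decreasing) auto
    then show "q ^ G / 2 \<le> 1 - a n" using claim[OF j(2)] by linarith
  qed (use q in simp)
qed

definition eta :: real where "eta = (SOME \<eta>. 0 < \<eta> \<and> (\<forall>n. \<eta> \<le> 1 - a n))"

lemma eta_pos: "0 < eta" and eta_le: "eta \<le> 1 - a n"
proof -
  have "0 < eta \<and> (\<forall>n. eta \<le> 1 - a n)"
    unfolding eta_def by (rule someI_ex) (use one_minus_a_lower in blast)
  then show "0 < eta" "eta \<le> 1 - a n" by auto
qed

lemma eta_less_1: "eta < 1"
  using eta_le[of 0] a_pos[of 0] by linarith

lemma len_tendsto_0: "len \<longlonglongrightarrow> 0"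
proof (rule tendsto_sandwich[OF _ _ tendsto_const])
  have "len n \<le> (1 - eta) ^ n" for n
  proof (induction n)
    case (Suc n)
    have "len n * a n \<le> (1 - eta) ^ n * (1 - eta)"
      using Suc eta_le[of n] eta_less_1 a_pos[of n] by (intro mult_mono) auto
    then show ?case by (simp add: len_Suc mult.commute)
  qed simp
  then show "\<forall>\<^sub>F n in sequentially. len n \<le> (1 - eta) ^ n" by simp
  show "(\<lambda>n. (1 - eta) ^ n) \<longlonglongrightarrow> 0"
    using eta_pos eta_less_1 by (intro LIMSEQ_realpow_zero) auto
qed (simp add: less_imp_le len_pos)

end

section \<open>The invariant pairing between the recurrence and its dual\<close>

context infinite_type_itm
begin

text \<open>If \<open>t n\<close> is the measure of \<open>J n\<close>, this is, after summation by
  parts, the sum of the weights \<open>e (n + 1)\<close>, \<open>e (n + 2)\<close>,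
  \<open>e (n + 2) - e n\<close> times the measures of \<open>D n\<close>, \<open>D (n + 1)\<close>,
  \<open>J (n + 2)\<close>. The weights are the return times for \<open>e = ht\<close> and the
  displacements for \<open>e = len\<close>.\<close>

definition pairing :: "(nat \<Rightarrow> real) \<Rightarrow> (nat \<Rightarrow> real) \<Rightarrow> nat \<Rightarrow> real" where
  "pairing e t n = e (n + 1) * t n + (e (n + 2) - e (n + 1)) * t (n + 1) - e n * t (n + 2)"

lemma pairing_Suc:
  fixes e t :: "nat \<Rightarrow> real"
  assumes "e (n + 3) = e (n + 2) + digit n * e (n + 1) - e n"
    and "t (n + 3) = t (n + 1) + digit n * t (n + 2) - t n"
  shows "pairing e t (Suc n) = pairing e t n"
proof -
  have "pairing e t (Suc n) = e (n + 2) * t (n + 1) + (e (n + 3) - e (n + 2)) * t (n + 2) - e (n + 1) * t (n + 3)"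
    by (simp add: pairing_def numeral_2_eq_2 numeral_3_eq_3)
  then show ?thesis unfolding pairing_def assms by algebra
qed

lemma ht_rec_real:
  "real (ht (n + 3)) = real (ht (n + 2)) + real (digit n) * real (ht (n + 1)) - real (ht n)"
  using arg_cong[OF ht_rec[of n], of real] by simp

lemma pairing_len:
  "pairing len t n = len n * (a n * t n - (a n - b n) * t (n + 1) - t (n + 2))"
  by (simp add: pairing_def len_Suc b_eq algebra_simps)

lemma pairing_len_eq_0:
  "pairing len t n = 0 \<longleftrightarrow> t (n + 2) = a n * t n - (a n - b n) * t (n + 1)"
  using len_pos[of n] by (auto simp: pairing_len)

text \<open>Coefficients of an integer relation between three consecutive lengths are transported by this recurrence.\<close>

fun dual :: "real \<Rightarrow> real \<Rightarrow> real \<Rightarrow> nat \<Rightarrow> real" where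
  "dual x y z 0 = x"
| "dual x y z (Suc 0) = y"
| "dual x y z (Suc (Suc 0)) = z"
| "dual x y z (Suc (Suc (Suc n))) =
     dual x y z (Suc n) + digit n * dual x y z (Suc (Suc n)) - dual x y z n"

lemma dual_rec: "dual x y z (n + 3) = dual x y z (n + 1) + digit n * dual x y z (n + 2) - dual x y z n"
  by (simp add: numeral_3_eq_3)

lemma dual_2: "dual x y z 2 = z"
  by (simp add: numeral_2_eq_2)

lemma dual_Ints: "x \<in> \<int> \<Longrightarrow> y \<in> \<int> \<Longrightarrow> z \<in> \<int> \<Longrightarrow> dual x y z n \<in> \<int>"
  by (induction x y z n rule: dual.induct) auto

lemma pairing_const:
  fixes e t :: "nat \<Rightarrow> real"
  assumes "\<And>n. e (n + 3) = e (n + 2) + digit n * e (n + 1) - e n"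
    and "\<And>n. t (n + 3) = t (n + 1) + digit n * t (n + 2) - t n"
  shows "pairing e t n = pairing e t 0"
  by (induction n) (simp_all only: pairing_Suc[OF assms])

lemma pairing_dual:
  fixes e :: "nat \<Rightarrow> real"
  assumes "\<And>n. e (n + 3) = e (n + 2) + digit n * e (n + 1) - e n"
  shows "pairing e (dual x y z) n = pairing e (dual x y z) 0"
  by (rule pairing_const) (fact assms dual_rec)+

end

section \<open>Decay, rational independence and near-integer multiples\<close>

context bounded_type_itm
begin

text \<open>The functional \<open>\<bar>t (n + 1)\<bar> + a n * \<bar>t n\<bar>\<close> drops by at least
  \<open>(1 - a n) * (1 - a (n + 1)) * \<bar>t (n + 1)\<bar>\<close> in each step.\<close>

lemma orthogonal_tendsto_0:
  assumes "\<And>n. pairing len t n = 0"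
  shows "t \<longlonglongrightarrow> 0"
proof -
  define V where "V n = \<bar>t (n + 1)\<bar> + a n * \<bar>t n\<bar>" for n
  have step: "V (Suc n) \<le> V n - eta\<^sup>2 * \<bar>t (n + 1)\<bar>" for n
  proof -
    have "b n < a n" by (rule b_less_a)
    have "\<bar>t (n + 2)\<bar> \<le> \<bar>a n * t n\<bar> + \<bar>(a n - b n) * t (n + 1)\<bar>"
      using assms[of n] unfolding pairing_len_eq_0 by linarith
    also have "\<dots> = a n * \<bar>t n\<bar> + (a n - a n * a (Suc n)) * \<bar>t (n + 1)\<bar>"
      using a_pos[of n] \<open>b n < a n\<close> by (simp add: abs_mult b_eq)
    finally have "V (Suc n) \<le> V n - (1 - a n) * (1 - a (Suc n)) * \<bar>t (n + 1)\<bar>"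
      by (simp add: V_def algebra_simps)
    moreover have "eta\<^sup>2 \<le> (1 - a n) * (1 - a (Suc n))"
      unfolding power2_eq_square using eta_le eta_pos a_less_1
      by (intro mult_mono) (auto simp: less_imp_le)
    then have "eta\<^sup>2 * \<bar>t (n + 1)\<bar> \<le> (1 - a n) * (1 - a (Suc n)) * \<bar>t (n + 1)\<bar>"
      by (rule mult_right_mono) simp
    ultimately show ?thesis by linarith
  qed
  have V_nonneg: "0 \<le> V n" for n using a_pos[of n] by (simp add: V_def)
  have "eta\<^sup>2 * (\<Sum>i<n. \<bar>t (i + 1)\<bar>) \<le> V 0 - V n" for n
  proof (induction n)
    case (Suc n) then show ?case using step[of n] by (simp add: algebra_simps)
  qed simp
  then have "(\<Sum>i<n. \<bar>t (i + 1)\<bar>) \<le> V 0 / eta\<^sup>2" for n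
    using V_nonneg[of n] eta_pos by (simp add: field_simps) (meson diff_left_mono order_trans diff_ge_0_iff_ge le_diff_eq add_increasing2)
  then have "summable (\<lambda>i. \<bar>t (i + 1)\<bar>)"
    by (intro summableI_nonneg_bounded) auto
  then have "(\<lambda>i. t (Suc i)) \<longlonglongrightarrow> 0"
    using summable_LIMSEQ_zero tendsto_rabs_zero_iff by fastforce
  then show ?thesis by (rule LIMSEQ_imp_Suc)
qed

text \<open>The condition on the initial values is orthogonality to \<open>len\<close> at index 0;
  constancy of the pairing carries it to all indices.\<close>

lemma dual_tendsto_0:
  assumes "\<alpha> * x - (\<alpha> - \<beta>) * y = z"
  shows "pairing len (dual x y z) n = 0" and "dual x y z \<longlonglongrightarrow> 0"
proof -
  have "pairing len (dual x y z) 0 = 0"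
    unfolding pairing_len_eq_0 using assms by (simp add: a_0 b_0 dual_2)
  then show *: "pairing len (dual x y z) n = 0" for n
    using pairing_dual[OF len_rec, of x y z n] by (rule trans[rotated])
  then show "dual x y z \<longlonglongrightarrow> 0" by (rule orthogonal_tendsto_0)
qed

text \<open>The initial values \<open>y + z\<close>, \<open>z\<close>, \<open>- x\<close> are those
  whose pairing with \<open>len\<close> at index 0 is the given relation. The resulting integer
  sequence tends to 0, so it is eventually 0; since \<open>t m\<close> enters the recurrence with
  coefficient -1, the zeros propagate back to index 0.\<close>

lemma rationally_independent:
  fixes x y z :: int
  assumes rel: "x + y * \<alpha> + z * \<beta> = 0"
  shows "x = 0 \<and> y = 0 \<and> z = 0"
proof -
  define t where "t = dual (y + z) z (- x)"
  have "t \<longlonglongrightarrow> 0" unfolding t_def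
    by (rule dual_tendsto_0(2)) (use rel in \<open>simp add: algebra_simps\<close>)
  then have "\<forall>\<^sub>F n in sequentially. \<bar>t n\<bar> < 1"
    using order_tendstoD(2)[OF tendsto_rabs_zero, of t sequentially 1] by simp
  then obtain N where N: "\<And>n. n \<ge> N \<Longrightarrow> \<bar>t n\<bar> < 1" by (auto simp: eventually_sequentially)
  have ev: "t n = 0" if "n \<ge> N" for n
  proof -
    have "t n \<in> \<int>" unfolding t_def by (rule dual_Ints) auto
    then show ?thesis using N[OF that] by (auto elim!: Ints_cases)
  qed
  have "\<forall>n\<ge>m. t n = 0" if "m \<le> N" for m
    using that
  proof (induction m rule: inc_induct)
    case base show ?case using ev by blast
  next
    case (step m)
    have "t (m + 3) = t (m + 1) + digit m * t (m + 2) - t m" unfolding t_def by (rule dual_rec)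
    then have "t m = 0" using step.IH by simp
    then show ?case using step.IH by (metis Suc_leI le_neq_implies_less)
  qed
  then have "t 0 = 0" "t 1 = 0" "t 2 = 0" by auto
  then have "real_of_int y + z = 0" "real_of_int z = 0" "real_of_int x = 0"
    by (simp_all add: t_def dual_2)
  then show ?thesis by simp
qed

text \<open>The pairing of two null sequences tends to 0 but is constant, so \<open>e\<close> is
  orthogonal to the sequences of \<open>dual_tendsto_0\<close>. Those starting with
  \<open>1, 0\<close> and \<open>1, 1\<close> read off \<open>e 1\<close> and
  \<open>e 2\<close>.\<close>

lemma decaying_eq_len:
  fixes e :: "nat \<Rightarrow> real"
  assumes rec: "\<And>n. e (n + 3) = e (n + 2) + digit n * e (n + 1) - e n"
    and lim: "e \<longlonglongrightarrow> 0"
  shows "e 1 = e 0 * \<alpha>" "e 2 = e 0 * \<beta>"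
proof -
  have zero: "pairing e (dual x y z) 0 = 0" if "\<alpha> * x - (\<alpha> - \<beta>) * y = z" for x y z
  proof -
    have t: "dual x y z \<longlonglongrightarrow> 0" by (rule dual_tendsto_0[OF that])
    define p where "p = pairing e (dual x y z) 0"
    have "pairing e (dual x y z) n = p" for n
      unfolding p_def by (rule pairing_dual[OF rec])
    moreover have "(\<lambda>n. pairing e (dual x y z) n) \<longlonglongrightarrow> 0 * 0 + (0 - 0) * 0 - 0 * 0"
      unfolding pairing_def
      by (intro tendsto_intros LIMSEQ_ignore_initial_segment lim t)
    ultimately have "p = 0" by (simp add: LIMSEQ_const_iff)
    then show ?thesis by (simp add: p_def)
  qed
  have "pairing e (dual 1 0 \<alpha>) 0 = 0" by (rule zero) simp
  then show "e 1 = e 0 * \<alpha>" by (simp add: pairing_def dual_2)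
  have "pairing e (dual 1 1 \<beta>) 0 = 0" by (rule zero) simp
  then show "e 2 = e 0 * \<beta>" by (simp add: pairing_def numeral_2_eq_2)
qed

text \<open>The coefficient of \<open>w n\<close> is -1, so the earliest term is an integer
  combination of the later ones. The extension is required because \<open>decaying_eq_len\<close>
  uses the recurrence from index 0 on.\<close>

lemma extend_recurrence_backwards:
  fixes w :: "nat \<Rightarrow> int"
  assumes "\<And>n. n \<ge> N \<Longrightarrow> w (n + 3) = w (n + 2) + digit n * w (n + 1) - w n"
  shows "\<exists>w' :: nat \<Rightarrow> int. (\<forall>n. w' (n + 3) = w' (n + 2) + digit n * w' (n + 1) - w' n) \<and> (\<forall>n\<ge>N. w' n = w n)"
  using assms
proof (induction N arbitrary: w)
  case 0 then show ?case by (intro exI[of _ w]) simp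
next
  case (Suc N)
  define v where "v = w(N := w (N + 2) + digit N * w (N + 1) - w (N + 3))"
  have "v (n + 3) = v (n + 2) + digit n * v (n + 1) - v n" if "n \<ge> N" for n
    using Suc.prems[of n] that by (cases "n = N") (simp_all add: v_def)
  then obtain w' :: "nat \<Rightarrow> int" where "\<forall>n. w' (n + 3) = w' (n + 2) + digit n * w' (n + 1) - w' n"
    "\<forall>n\<ge>N. w' n = v n" using Suc.IH by blast
  then show ?case by (intro exI[of _ w']) (auto simp: v_def)
qed

lemma near_integer_multiples:
  fixes \<theta> :: real and w :: "nat \<Rightarrow> int"
  assumes lim: "(\<lambda>n. \<theta> * ht n - w n) \<longlonglongrightarrow> 0"
  shows "\<theta> \<in> \<int>"
proof -
  define e where "e n = \<theta> * ht n - w n" for n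
  have lim: "(\<lambda>n. e (n + k)) \<longlonglongrightarrow> 0" for k
    using lim unfolding e_def by (rule LIMSEQ_ignore_initial_segment)
  \<comment> \<open>The defect of \<open>w\<close> in the recurrence. It is an integer and tends to
    0 because the digits are bounded, so it vanishes eventually.\<close>
  define r where "r n = w (n + 3) - w (n + 2) - digit n * w (n + 1) + w n" for n
  have r: "real_of_int (r n) = - (e (n + 3) - e (n + 2) - digit n * e (n + 1) + e n)" for n
    unfolding r_def e_def ht_rec_real by (simp add: algebra_simps)
  have "(\<lambda>n. digit n * e (n + 1)) \<longlonglongrightarrow> 0"
  proof (rule Lim_null_comparison)
    show "\<forall>\<^sub>F n in sequentially. norm (digit n * e (n + 1)) \<le> K * \<bar>e (n + 1)\<bar>"
      using digit_le by (auto simp: abs_mult mult_right_mono)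
    show "(\<lambda>n. K * \<bar>e (n + 1)\<bar>) \<longlonglongrightarrow> 0"
      using tendsto_mult_right_zero[OF tendsto_rabs_zero[OF lim[of 1]]] by simp
  qed
  then have "(\<lambda>n. real_of_int (r n)) \<longlonglongrightarrow> - (0 - 0 - 0 + 0)"
    unfolding r using lim[of 0] by (intro tendsto_intros lim) simp_all
  then have "\<forall>\<^sub>F n in sequentially. \<bar>real_of_int (r n)\<bar> < 1"
    using order_tendstoD(2)[OF tendsto_rabs_zero, of "\<lambda>n. real_of_int (r n)" sequentially 1] by simp
  then obtain N where N: "\<And>n. n \<ge> N \<Longrightarrow> \<bar>real_of_int (r n)\<bar> < 1"
    by (auto simp: eventually_sequentially)
  have "w (n + 3) = w (n + 2) + digit n * w (n + 1) - w n" if "n \<ge> N" for n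
    using N[OF that] unfolding r_def by linarith
  then obtain w' :: "nat \<Rightarrow> int" where w': "\<And>n. w' (n + 3) = w' (n + 2) + digit n * w' (n + 1) - w' n"
    and eq: "\<And>n. n \<ge> N \<Longrightarrow> w' n = w n" using extend_recurrence_backwards by blast
  define e' where "e' n = \<theta> * ht n - w' n" for n
  have e'_rec: "e' (n + 3) = e' (n + 2) + digit n * e' (n + 1) - e' n" for n
    unfolding e'_def ht_rec_real w' by (simp add: algebra_simps)
  have "e' \<longlonglongrightarrow> 0"
  proof (rule Lim_transform_eventually)
    show "e \<longlonglongrightarrow> 0" using lim[of 0] by simp
    show "\<forall>\<^sub>F n in sequentially. e n = e' n"
      unfolding eventually_sequentially using eq
      by (intro exI[of _ N]) (auto simp: e_def e'_def)
  qed
  note e' = decaying_eq_len[OF e'_rec this]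
  \<comment> \<open>\<open>ht 0 = 0\<close> makes the factor \<open>e' 0\<close> the integer
    \<open>- w' 0\<close>, and \<open>ht 1 = ht 2 = 1\<close> lets \<theta> cancel when the two
    equations are subtracted.\<close>
  have w1: "\<theta> - w' 1 = - w' 0 * \<alpha>" and "\<theta> - w' 2 = - w' 0 * \<beta>"
    using e' by (simp_all add: e'_def numeral_2_eq_2)
  then have "real_of_int (w' 2 - w' 1) + w' 0 * \<alpha> + real_of_int (- w' 0) * \<beta> = 0" by simp
  then have "w' 0 = 0" using rationally_independent by blast
  then have "\<theta> = w' 1" using w1 by simp
  then show ?thesis by simp
qed

text \<open>\<open>t n\<close> plays the role of the measure of \<open>J n\<close>; the two pairings express that the towers
  have total mass 1 and that the mean displacement vanishes.\<close>

definition frequency :: "(nat \<Rightarrow> real) \<Rightarrow> bool" where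
  "frequency t \<longleftrightarrow> (\<forall>n. 0 \<le> t n \<and> t (Suc n) \<le> t n \<and> pairing ht t n = 1) \<and> pairing len t 0 = 0"

lemma frequency_antimono: "frequency t \<Longrightarrow> m \<le> n \<Longrightarrow> t n \<le> t m"
  by (rule lift_Suc_antimono_le[of t]) (auto simp: frequency_def)

text \<open>Subtracting the mass identities at \<open>n\<close> and \<open>n + 1\<close> leaves
  \<open>ht (n + 1)\<close> times the defect of the dual recurrence.\<close>

lemma frequency_rec:
  fixes t :: "nat \<Rightarrow> real"
  assumes "frequency t"
  shows "t (n + 3) = t (n + 1) + digit n * t (n + 2) - t n"
proof -
  have "real (ht (n + 1)) > 0" using ht_pos[of "n + 1"] by simp
  moreover note ht_rec_real[of n]
  moreover have "pairing ht t (n + 1) = pairing ht t n" using assms by (simp add: frequency_def)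
  then have "ht (n + 2) * t (n + 1) + (real (ht (n + 3)) - ht (n + 2)) * t (n + 2) - ht (n + 1) * t (n + 3)
      = ht (n + 1) * t n + (real (ht (n + 2)) - ht (n + 1)) * t (n + 1) - ht n * t (n + 2)"
    by (simp add: pairing_def numeral_3_eq_3)
  ultimately have "ht (n + 1) * (t (n + 3) - (t (n + 1) + digit n * t (n + 2) - t n)) = 0"
    by algebra
  then show ?thesis using \<open>real (ht (n + 1)) > 0\<close> by simp
qed

text \<open>All three return times to \<open>J n\<close> are at most \<open>ht (n + 2)\<close>,
  while the towers have total mass 1.\<close>

lemma frequency_lower:
  fixes t :: "nat \<Rightarrow> real"
  assumes "frequency t"
  shows "1 \<le> ht (n + 2) * t n"
proof -
  have t: "0 \<le> t (n + 2)" "t (n + 1) \<le> t n" and 1: "pairing ht t n = 1"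
    using assms by (auto simp: frequency_def)
  have "(real (ht (n + 2)) - ht (n + 1)) * t (n + 1) \<le> (real (ht (n + 2)) - ht (n + 1)) * t n"
    using t ht_mono[of "n + 1" "n + 2"] by (intro mult_left_mono) auto
  moreover have "0 \<le> ht n * t (n + 2)" using t by simp
  ultimately show ?thesis using 1 by (simp add: pairing_def algebra_simps)
qed

lemma frequency_pos:
  fixes t :: "nat \<Rightarrow> real"
  assumes "frequency t"
  shows "0 < t n"
  using frequency_lower[OF assms, of n] ht_pos[of "n + 2"]
    zero_less_mult_pos[of "real (ht (n + 2))" "t n"] by simp

lemma frequency_second_order:
  fixes t :: "nat \<Rightarrow> real"
  assumes "frequency t"
  shows "t (n + 2) = a n * t n - (a n - b n) * t (n + 1)"
proof -
  have "pairing len t n = pairing len t 0" by (rule pairing_const[OF len_rec frequency_rec[OF assms]])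
  then have "pairing len t n = 0" using assms by (simp add: frequency_def)
  then show ?thesis by (simp only: pairing_len_eq_0)
qed

section \<open>Growth of return times and mass of towers\<close>

lemma ht_growth: "0 < n \<Longrightarrow> ht (n + d) \<le> (K + 1) ^ d * ht n"
proof (induction d)
  case (Suc d)
  have "ht (m + 1) \<le> (K + 1) * ht m" if m: "0 < m" for m
  proof -
    have "m = 1 \<or> m = 2 + (m - 2)" using m by arith
    then consider "m = 1" | l where "m = Suc (Suc l)" by (metis add_2_eq_Suc)
    then show ?thesis
    proof cases
      case (2 l)
      have "digit l * ht (Suc l) \<le> K * ht (Suc (Suc l))" by (intro mult_mono digit_le ht_mono) auto
      then show ?thesis using 2 by simp
    qed simp
  qed
  from this[of "n + d"] Suc have "ht (n + Suc d) \<le> (K + 1) * ht (n + d)" by simp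
  also have "\<dots> \<le> (K + 1) * ((K + 1) ^ d * ht n)" using Suc by (intro mult_le_mono2) simp
  finally show ?case by (simp only: power_Suc mult.assoc)
qed simp

text \<open>By the dual recurrence,
  \<open>t n - t (n + 1) = digit n * t (n + 2) - t (n + 3)\<close>. A digit 1 turns this into the
  same difference at \<open>n + 2\<close>, a digit at least 2 bounds it below by
  \<open>t (n + 2)\<close>, and \<open>gap\<close> limits the number of passages.\<close>

lemma frequency_difference:
  fixes t :: "nat \<Rightarrow> real"
  assumes "frequency t"
  shows "t (n + 2 * G + 2) \<le> t n - t (n + 1)"
proof -
  have nn: "0 \<le> t m" for m using assms by (simp add: frequency_def)
  have mono: "t (m + 1) \<le> t m" for m using assms by (simp add: frequency_def)
  have claim: "t (n + 2 * j + 2) \<le> t n - t (n + 1)" if "2 \<le> digit (n + 2 * j)" for j n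
    using that
  proof (induction j arbitrary: n)
    case 0
    have "2 * t (n + 2) \<le> digit n * t (n + 2)" using 0 nn by (intro mult_right_mono) auto
    then show ?case using frequency_rec[OF assms, of n] mono[of "n + 2"] by (simp add: numeral_3_eq_3)
  next
    case (Suc j)
    have "t (n + 2 + 2 * j + 2) \<le> t (n + 2) - t (n + 2 + 1)"
      by (rule Suc.IH) (use Suc.prems in simp)
    moreover have "1 * t (n + 2) \<le> digit n * t (n + 2)"
      using nn digit_ge_1[of n] by (intro mult_right_mono) auto
    ultimately show ?case using frequency_rec[OF assms, of n] by (simp add: numeral_3_eq_3)
  qed
  obtain j where j: "j \<le> G" "2 \<le> digit (n + 2 * j)" using gap by blast
  have "t (n + 2 * G + 2) \<le> t (n + 2 * j + 2)" using j by (intro frequency_antimono[OF assms]) simp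
  then show ?thesis using claim[OF j(2)] by simp
qed

text \<open>Being a difference of return times, \<open>hs m\<close> might be much smaller than
  either of them. A digit at least 2 shortly before \<open>m\<close> adds a full return time to it
  by \<open>hs_Suc\<close>.\<close>

lemma hs_lower: "2 * G < m \<Longrightarrow> ht (m - 2 * G) \<le> hs m"
proof -
  assume m: "2 * G < m"
  obtain j where j: "j \<le> G" "2 \<le> digit (m - 1 - 2 * G + 2 * j)" using gap by blast
  define i where "i = m - 1 - 2 * G + 2 * j"
  have i: "2 \<le> digit i" "m - 2 * G \<le> Suc i" "Suc i \<le> m" using j m by (auto simp: i_def)
  have "ht (m - 2 * G) \<le> ht (Suc i)" by (intro ht_mono i)
  also have "\<dots> \<le> (digit i - 1) * ht (Suc i)" using mult_le_mono1[of 1 "digit i - 1" "ht (Suc i)"] i(1) by (metis diff_le_mono diff_Suc_1 numeral_2_eq_2 mult_1 One_nat_def)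
  also have "\<dots> \<le> hs (Suc i)" by (simp add: hs_Suc)
  also have "\<dots> \<le> hs m" by (intro hs_mono i)
  finally show ?thesis .
qed

text \<open>For measures, the right-hand side is the mass of the tower of height \<open>hs m\<close>
  over \<open>D (m + 2)\<close>, on which eigenfunctions are tested. The exponent is the distance
  from \<open>m - 2 * G\<close>, where \<open>ht\<close> bounds \<open>hs m\<close> from below, to
  \<open>m + 2 * G + 6\<close>, where \<open>ht\<close> controls the base measure; each index costs
  a factor of at most \<open>K + 1\<close>.\<close>

lemma tower_mass_lower:
  fixes t :: "nat \<Rightarrow> real"
  assumes "frequency t" and m: "2 * G < m"
  shows "1 / (real K + 1) ^ (4 * G + 6) \<le> hs m * (t (m + 2) - t (m + 3))"
proof -
  define h where "h = real (ht (m - 2 * G))"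
  have h: "0 < h" using m ht_pos[of "m - 2 * G"] by (simp add: h_def)
  have le: "t (m + 2 * G + 4) \<le> t (m + 2) - t (m + 3)"
    using frequency_difference[OF assms(1), of "m + 2"] by (simp add: eval_nat_numeral)
  have "1 \<le> ht (m + 2 * G + 6) * t (m + 2 * G + 4)"
    using frequency_lower[OF assms(1), of "m + 2 * G + 4"] by (simp add: eval_nat_numeral)
  moreover have "ht (m + 2 * G + 6) \<le> (K + 1) ^ (4 * G + 6) * ht (m - 2 * G)"
    using ht_growth[of "m - 2 * G" "4 * G + 6"] m by (simp add: add.commute add.left_commute)
  then have "real (ht (m + 2 * G + 6)) \<le> (real K + 1) ^ (4 * G + 6) * h"
    unfolding h_def by (simp flip: of_nat_Suc of_nat_power of_nat_mult add: add.commute)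
  moreover have "0 < t (m + 2 * G + 4)" by (rule frequency_pos[OF assms(1)])
  ultimately have "1 \<le> (real K + 1) ^ (4 * G + 6) * h * t (m + 2 * G + 4)"
    by (meson less_imp_le mult_right_mono order_trans)
  also have "\<dots> \<le> (real K + 1) ^ (4 * G + 6) * h * (t (m + 2) - t (m + 3))"
    using h by (intro mult_left_mono le) auto
  finally have "1 \<le> (real K + 1) ^ (4 * G + 6) * h * (t (m + 2) - t (m + 3))" .
  then have "1 / (real K + 1) ^ (4 * G + 6) \<le> h * (t (m + 2) - t (m + 3))"
    by (simp add: field_simps)
  also have "\<dots> \<le> hs m * (t (m + 2) - t (m + 3))"
  proof (rule mult_right_mono)
    show "h \<le> hs m" using hs_lower[OF m] by (simp add: h_def)
    show "0 \<le> t (m + 2) - t (m + 3)"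
      using assms(1) by (simp add: frequency_def numeral_3_eq_3)
  qed
  finally show ?thesis .
qed

text \<open>The ratios satisfy \<open>r n = a n / (r (n + 1) + d n)\<close>, which contracts
  relative errors because \<open>d n\<close> is bounded below. Information flows from high to low
  indices: an a priori bound valid at every index, pulled back \<open>m\<close> times, gains the
  factor \<open>c ^ m\<close>.\<close>

lemma frequency_unique:
  assumes s: "frequency s" and t: "frequency t"
  shows "s = t"
proof -
  define \<delta> where "\<delta> = eta / (real K + 1)"
  have \<delta>: "0 < \<delta>" using eta_pos by (simp add: \<delta>_def)
  define d where "d n = a n - b n" for n
  have d: "\<delta> \<le> d n" for n
  proof -
    have "1 / (real K + 1) * eta \<le> a n * (1 - a (Suc n))"
      using a_pos[of n] eta_pos by (intro mult_mono a_lower eta_le) auto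
    then show ?thesis by (simp add: \<delta>_def d_def b_eq algebra_simps)
  qed
  define r where "r u n = u (Suc n) / u n" for u :: "nat \<Rightarrow> real" and n
  have r: "0 < r u n" "r u n \<le> 1" "r u n * (r u (Suc n) + d n) = a n" if "frequency u" for u n
  proof -
    have pos: "0 < u m" for m by (rule frequency_pos[OF that])
    show "0 < r u n" using pos by (simp add: r_def)
    show "r u n \<le> 1" using pos that by (simp add: r_def frequency_def)
    have "u (Suc (Suc n)) = a n * u n - d n * u (Suc n)"
      using frequency_second_order[OF that, of n] by (simp add: d_def)
    then have "u (Suc (Suc n)) + d n * u (Suc n) = a n * u n" by simp
    then show "r u n * (r u (Suc n) + d n) = a n"
      using pos[of n] pos[of "Suc n"] by (simp add: r_def field_simps)
  qed
  define c where "c = 1 / (1 + \<delta>)"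
  have c: "0 < c" "c < 1" using \<delta> by (auto simp: c_def)
  \<comment> \<open>The map reverses order, so \<open>u\<close> and \<open>v\<close> change roles;
    for this reason \<open>iter\<close> carries both inequalities at once.\<close>
  have contract: "r u n \<le> (1 + c * Y) * r v n"
    if Y: "0 \<le> Y" and bound: "r v (Suc n) \<le> (1 + Y) * r u (Suc n)"
      and u: "frequency u" and v: "frequency v" for u v n Y
  proof -
    have "r u (Suc n) * \<delta> \<le> d n" using r(1,2)[OF u, of "Suc n"] d[of n] \<delta>
      by (smt (verit) mult_left_le_one_le)
    then have "r u (Suc n) \<le> c * (r u (Suc n) + d n)"
      using \<delta> by (simp add: c_def field_simps)
    then have "Y * r u (Suc n) \<le> Y * (c * (r u (Suc n) + d n))" using Y by (rule mult_left_mono)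
    then have "r v (Suc n) + d n \<le> (1 + c * Y) * (r u (Suc n) + d n)"
      using bound by (simp add: algebra_simps)
    then have "r v n * (r v (Suc n) + d n) \<le> r v n * ((1 + c * Y) * (r u (Suc n) + d n))"
      using r(1)[OF v, of n] by (intro mult_left_mono) auto
    then have "r u n * (r u (Suc n) + d n) \<le> ((1 + c * Y) * r v n) * (r u (Suc n) + d n)"
      using r(3)[OF u, of n] r(3)[OF v, of n] by (simp add: mult_ac)
    moreover have "0 < r u (Suc n) + d n" using r(1)[OF u, of "Suc n"] d[of n] \<delta> by linarith
    ultimately show ?thesis by (rule mult_right_le_imp_le)
  qed
  \<comment> \<open>Since \<open>d n \<le> 1\<close> and all ratios are at most 1, the lower bound
    on \<open>a n\<close> makes each ratio at least \<open>1 / X\<close>.\<close>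
  define X where "X = 2 * (real K + 1)"
  have start: "r u n \<le> (1 + X) * r v n" if u: "frequency u" and v: "frequency v" for u v n
  proof -
    have "d n \<le> 1" using b_pos[of n] a_less_1[of n] by (simp add: d_def)
    then have "r v n * (r v (Suc n) + d n) \<le> r v n * 2"
      using r(1)[OF v, of n] r(2)[OF v, of "Suc n"] by (intro mult_left_mono) auto
    then have "a n \<le> r v n * 2" using r(3)[OF v, of n] by simp
    then have "1 / (real K + 1) \<le> r v n * 2" using a_lower[of n] by linarith
    then have "1 \<le> X * r v n" by (simp add: X_def field_simps)
    then show ?thesis using r(1)[OF v, of n] r(2)[OF u, of n] by (simp add: algebra_simps)
  qed
  have iter: "\<forall>n. r s n \<le> (1 + c ^ m * X) * r t n \<and> r t n \<le> (1 + c ^ m * X) * r s n" for m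
  proof (induction m)
    case 0 then show ?case using start s t by simp
  next
    case (Suc m)
    have "0 \<le> c ^ m * X" using c by (simp add: X_def)
    then show ?case using contract[of "c ^ m * X"] Suc s t by (simp add: mult.assoc)
  qed
  have le: "r u n \<le> r v n" if "\<And>m. r u n \<le> (1 + c ^ m * X) * r v n" for u v n
  proof (rule LIMSEQ_le_const)
    have "(\<lambda>m. (1 + c ^ m * X) * r v n) \<longlonglongrightarrow> (1 + 0 * X) * r v n"
      by (intro tendsto_intros LIMSEQ_realpow_zero) (use c in auto)
    then show "(\<lambda>m. (1 + c ^ m * X) * r v n) \<longlonglongrightarrow> r v n" by simp
  qed (use that in auto)
  have req: "r s n = r t n" for n
    using le[of s n t] le[of t n s] iter by (meson order_antisym)
  \<comment> \<open>The mass identity at index 0 fixes the scale that the ratios leave open.\<close>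
  have "u 0 = 1" if "frequency u" for u
  proof -
    have "pairing ht u 0 = 1" using that by (simp add: frequency_def)
    then show ?thesis by (simp add: pairing_def numeral_2_eq_2)
  qed
  note start = this[OF s] this[OF t]
  show ?thesis
  proof
    fix n show "s n = t n"
    proof (induction n)
      case 0 show ?case using start by simp
    next
      case (Suc n)
      then show ?case using req[of n] frequency_pos[OF s, of n] by (simp add: r_def)
    qed
  qed
qed

end

section \<open>Towers and unique ergodicity\<close>

context infinite_type_itm
begin

definition base :: "nat \<Rightarrow> nat \<Rightarrow> real set" where
  "base n j = (if j = 0 then D n else if j = 1 then D (n + 1) else J (n + 2))"

definition height :: "nat \<Rightarrow> nat \<Rightarrow> nat" where
  "height n j = (if j = 0 then ht (n + 1) else if j = 1 then ht (n + 2) else hs n)"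

lemma height_pos: "0 < height n j"
  by (simp add: height_def ht_pos hs_pos)

lemma base_subset: "base n j \<subseteq> J n"
  using J_Suc[of n] J_Suc[of "Suc n"] by (auto simp: base_def)

lemma J_eq_bases: "x \<in> J n \<Longrightarrow> \<exists>j<3. x \<in> base n j"
proof -
  assume "x \<in> J n"
  then consider "x \<in> D n" | "x \<in> D (n + 1)" | "x \<in> J (n + 2)"
    using J_Suc[of n] J_Suc[of "Suc n"] by auto
  then show ?thesis
  proof cases
    case 1 then show ?thesis by (intro exI[of _ 0]) (simp add: base_def)
  next
    case 2 then show ?thesis by (intro exI[of _ 1]) (simp add: base_def)
  next
    case 3 then show ?thesis by (intro exI[of _ 2]) (simp add: base_def)
  qed
qed

lemma base_disjoint: "i < 3 \<Longrightarrow> j < 3 \<Longrightarrow> x \<in> base n i \<Longrightarrow> x \<in> base n j \<Longrightarrow> i = j"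
  using J_Suc[of n] J_Suc[of "Suc n"] D_J_disjoint[of n] D_J_disjoint[of "Suc n"]
  by (auto simp: base_def split: if_splits)

lemma
  assumes x: "x \<in> base n j"
  shows base_return: "(T ^^ height n j) x \<in> J n"
    and base_first: "0 < i \<Longrightarrow> i < height n j \<Longrightarrow> (T ^^ i) x \<notin> J n"
    and base_translation: "y \<in> base n j \<Longrightarrow> i \<le> height n j \<Longrightarrow> (T ^^ i) x - (T ^^ i) y = x - y"
proof -
  define v where "v = (if j = 0 then len (n + 1) else if j = 1 then len (n + 2) else len (n + 2) - len n)"
  have ret: "returns (J n) (base n j) (height n j) v"
    using first_return[of n] by (simp add: base_def height_def v_def)
  then show "0 < i \<Longrightarrow> i < height n j \<Longrightarrow> (T ^^ i) x \<notin> J n"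
    and "y \<in> base n j \<Longrightarrow> i \<le> height n j \<Longrightarrow> (T ^^ i) x - (T ^^ i) y = x - y"
    using x by (auto simp: returns_def)
  have "(T ^^ height n j) x = x + v" using ret x by (auto simp: returns_def)
  moreover have "x + v \<in> J n"
    using x len_pos[of "n + 1"] len_pos[of "n + 2"] len_less[of n] len_less[of "n + 1"]
    by (auto simp: base_def v_def J_def D_def split: if_splits)
  ultimately show "(T ^^ height n j) x \<in> J n" by simp
qed

lemma base_diam: "x \<in> base n j \<Longrightarrow> y \<in> base n j \<Longrightarrow> \<bar>x - y\<bar> \<le> len n"
proof -
  assume "x \<in> base n j" "y \<in> base n j"
  then have "x \<in> J n" "y \<in> J n" using base_subset by auto
  then show ?thesis by (auto simp: J_def)
qed

lemma J_subset: "J n \<subseteq> {0..1}"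
  using J_antimono[of 0 n] J_0 by simp

text \<open>Looking back from time \<open>N\<close> to the last visit in \<open>J n\<close> locates every orbit in exactly
  one tower level; \<open>T\<close> itself is not injective.\<close>

lemma tower_partition:
  obtains N where "\<And>j. height n j \<le> N"
    "\<And>x. x \<in> {0..1} \<Longrightarrow> (\<Sum>j<3. \<Sum>i<height n j. indicator (base n j) ((T ^^ (N - i)) x)) = (1::real)"
proof -
  obtain N0 where N0: "\<And>x. x \<in> {0..1} \<Longrightarrow> \<exists>i\<le>N0. (T ^^ i) x \<in> J n" using enters_J[of n] by blast
  define N where "N = N0 + ht (n + 1) + ht (n + 2) + hs n"
  have hN: "height n j \<le> N" for j by (simp add: height_def N_def)
  have "(\<Sum>j<3. \<Sum>i<height n j. indicator (base n j) ((T ^^ (N - i)) x)) = (1::real)"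
    if x: "x \<in> {0..1}" for x
  proof -
    define Z where "Z = (SIGMA j:{..<3::nat}. {..<height n j})"
    have hit: "(T ^^ (N - i)) x \<in> base n j \<and> (T ^^ (N - i')) x \<in> base n j' \<Longrightarrow> i < height n j \<Longrightarrow>
      i' < height n j' \<Longrightarrow> i \<le> i'" for i i' j j'
    proof (rule ccontr, elim conjE)
      assume *: "(T ^^ (N - i)) x \<in> base n j" "(T ^^ (N - i')) x \<in> base n j'" "i < height n j"
        "i' < height n j'" "\<not> i \<le> i'"
      have "N - i' = (i - i') + (N - i)" using * hN[of j] by simp
      then have "(T ^^ (i - i')) ((T ^^ (N - i)) x) \<in> J n"
        using *(2) base_subset by (metis comp_apply funpow_add subsetD)
      then show False using base_first[OF *(1), of "i - i'"] * by simp
    qed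
    have uniq: "z = z'" if "z \<in> Z" "z' \<in> Z" "(T ^^ (N - snd z)) x \<in> base n (fst z)"
      "(T ^^ (N - snd z')) x \<in> base n (fst z')" for z z'
    proof -
      have "snd z = snd z'" using that hit by (auto simp: Z_def intro!: order_antisym)
      moreover have "fst z = fst z'"
        using that base_disjoint[of "fst z" "fst z'"] calculation by (auto simp: Z_def)
      ultimately show ?thesis by (simp add: prod_eq_iff)
    qed
    define P where "P = {p. p \<le> N \<and> (T ^^ p) x \<in> J n}"
    have fin: "finite P" and "P \<noteq> {}" using N0[OF x] by (auto simp: P_def N_def intro: trans_le_add1)
    define p where "p = Max P"
    have p: "p \<le> N" "(T ^^ p) x \<in> J n" using Max_in[OF fin \<open>P \<noteq> {}\<close>] by (auto simp: P_def p_def)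
    obtain j where j: "j < 3" "(T ^^ p) x \<in> base n j" using J_eq_bases[OF p(2)] by blast
    have "N - p < height n j"
    proof (rule ccontr)
      assume "\<not> N - p < height n j"
      then have "height n j + p \<in> P"
        using base_return[OF j(2)] p by (simp add: P_def funpow_add)
      then have "height n j + p \<le> p" unfolding p_def by (rule Max_ge[OF fin])
      then show False using height_pos[of n j] by simp
    qed
    then have z: "(j, N - p) \<in> Z" "(T ^^ (N - snd (j, N - p))) x \<in> base n (fst (j, N - p))"
      using j p by (auto simp: Z_def)
    have "(\<Sum>j<3. \<Sum>i<height n j. indicator (base n j) ((T ^^ (N - i)) x)) =
        (\<Sum>z\<in>Z. indicator (base n (fst z)) ((T ^^ (N - snd z)) x) :: real)"
      unfolding Z_def by (subst sum.Sigma) (auto simp: case_prod_beta)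
    also have "\<dots> = (\<Sum>z\<in>Z. if z = (j, N - p) then 1 else 0)"
    proof (rule sum.cong[OF refl])
      fix z' assume "z' \<in> Z"
      then have "(T ^^ (N - snd z')) x \<in> base n (fst z') \<longleftrightarrow> z' = (j, N - p)"
        using uniq[OF _ z(1) _ z(2)] z(2) by blast
      then show "indicator (base n (fst z')) ((T ^^ (N - snd z')) x) = (if z' = (j, N - p) then 1 else (0::real))"
        by (simp add: indicator_def)
    qed
    also have "\<dots> = 1" using z(1) by (subst sum.delta) (auto simp: Z_def)
    finally show ?thesis .
  qed
  then show thesis using that hN by blast
qed

lemma itm_measurable [measurable]: "T \<in> borel_measurable borel"
  unfolding itm_def[abs_def] by measurable

lemma funpow_itm_measurable [measurable]: "(T ^^ n) \<in> borel_measurable borel"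
  by (induction n) (auto intro: measurable_comp)

lemma base_measurable [measurable]: "base n j \<in> sets borel"
  and J_measurable [measurable]: "J n \<in> sets borel"
  and D_measurable [measurable]: "D n \<in> sets borel"
  by (auto simp: base_def D_def J_def)

end

text \<open>The measure lives on the whole line rather than on the attractor, so that characteristic
  functions and weak convergence of real distributions apply.\<close>

locale invariant_distribution = infinite_type_itm + real_distribution M for M :: "real measure" +
  assumes invariant: "distr M borel (itm \<alpha> \<beta>) = M"
    and support: "AE x in M. x \<in> {0..1}"
begin

lemma invariant_funpow: "distr M borel (T ^^ n) = M"
proof (induction n)
  case 0 show ?case by (simp add: distr_id2 id_def)
next
  case (Suc n)
  then show ?case using invariant distr_distr[of T borel borel "T ^^ n" M] by (simp add: comp_def)
qed

lemma AE_funpow: "AE x in M. P x \<Longrightarrow> AE x in M. P ((T ^^ n) x)"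
  by (rule AE_distrD[of "T ^^ n" M borel P]) (simp, subst invariant_funpow)

lemma integral_funpow:
  fixes f :: "real \<Rightarrow> 'b :: {banach, second_countable_topology}"
  assumes "f \<in> borel_measurable borel"
  shows "(\<integral>x. f ((T ^^ n) x) \<partial>M) = (\<integral>x. f x \<partial>M)"
  using integral_distr[of "T ^^ n" M borel f] assms by (simp add: invariant_funpow)

lemma integrable_funpow:
  fixes f :: "real \<Rightarrow> 'b :: {banach, second_countable_topology}"
  assumes "integrable M f"
  shows "integrable M (\<lambda>x. f ((T ^^ n) x))"
  using integrable_distr[of "T ^^ n" M borel f] assms by (simp add: invariant_funpow)

text \<open>The images of a base need not be disjoint, so the integral is not cut along them. The
  integrand is moved to time \<open>N\<close>, split by the last visit to \<open>J n\<close>, and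
  each piece is moved back to its base by invariance.\<close>

lemma Kac:
  fixes F :: "real \<Rightarrow> 'b :: {banach, second_countable_topology}"
  assumes F: "integrable M F"
  shows "(\<integral>x. F x \<partial>M) = (\<Sum>j<3. \<Sum>i<height n j. \<integral>x. indicator (base n j) x *\<^sub>R F ((T ^^ i) x) \<partial>M)"
proof -
  obtain N where N: "\<And>j. height n j \<le> N"
    and one: "\<And>x. x \<in> {0..1} \<Longrightarrow> (\<Sum>j<3. \<Sum>i<height n j. indicator (base n j) ((T ^^ (N - i)) x)) = (1::real)"
    using tower_partition by blast
  have [measurable]: "F \<in> borel_measurable borel" using borel_measurable_integrable[OF F] by simp
  have int: "integrable M (\<lambda>x. indicator (base n j) ((T ^^ (N - i)) x) *\<^sub>R F ((T ^^ N) x))" for i j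
    by (rule Bochner_Integration.integrable_bound[OF integrable_funpow[OF F, of N]])
      (auto simp: indicator_def)
  have "(\<integral>x. F x \<partial>M) = (\<integral>x. F ((T ^^ N) x) \<partial>M)" by (simp add: integral_funpow)
  also have "\<dots> = (\<integral>x. (\<Sum>j<3. \<Sum>i<height n j. indicator (base n j) ((T ^^ (N - i)) x) *\<^sub>R F ((T ^^ N) x)) \<partial>M)"
  proof (rule integral_cong_AE)
    show "AE x in M. F ((T ^^ N) x) = (\<Sum>j<3. \<Sum>i<height n j. indicator (base n j) ((T ^^ (N - i)) x) *\<^sub>R F ((T ^^ N) x))"
      using support
    proof eventually_elim
      case (elim x)
      show ?case using one[OF elim] by (simp flip: scaleR_left.sum)
    qed
  qed measurable
  also have "\<dots> = (\<Sum>j<3. \<Sum>i<height n j. \<integral>x. indicator (base n j) ((T ^^ (N - i)) x) *\<^sub>R F ((T ^^ N) x) \<partial>M)"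
    by (simp only: Bochner_Integration.integral_sum Bochner_Integration.integrable_sum int)
  also have "\<dots> = (\<Sum>j<3. \<Sum>i<height n j. \<integral>x. indicator (base n j) x *\<^sub>R F ((T ^^ i) x) \<partial>M)"
  proof (intro sum.cong refl)
    fix i j assume "i \<in> {..<height n j}"
    then have "i + (N - i) = N" using N[of j] by simp
    then have "(T ^^ N) x = (T ^^ i) ((T ^^ (N - i)) x)" for x by (metis comp_apply funpow_add)
    then show "(\<integral>x. indicator (base n j) ((T ^^ (N - i)) x) *\<^sub>R F ((T ^^ N) x) \<partial>M)
        = (\<integral>x. indicator (base n j) x *\<^sub>R F ((T ^^ i) x) \<partial>M)"
      using integral_funpow[of "\<lambda>x. indicator (base n j) x *\<^sub>R F ((T ^^ i) x)" "N - i"] by simp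
  qed
  finally show ?thesis .
qed

lemma prob_D: "prob (D n) = prob (J n) - prob (J (Suc n))"
proof -
  have "prob (J n) = prob (D n) + prob (J (Suc n))"
    unfolding J_Suc[of n] using D_J_disjoint by (intro finite_measure_Union) auto
  then show ?thesis by simp
qed

lemma integrable_indicator_borel: "A \<in> sets borel \<Longrightarrow> integrable M (indicator A :: real \<Rightarrow> real)"
  by (rule integrable_const_bound[of _ 1]) auto

lemma tower_mass: "(\<Sum>j<3. height n j * prob (base n j)) = 1"
  using Kac[of "\<lambda>_. 1::real" n] prob_space by simp

lemma pairing_prob: "pairing ht (\<lambda>n. prob (J n)) n = 1"
proof -
  have "real (hs n) = real (ht (n + 2)) - real (ht n)" using hs_eq[of n] by linarith
  moreover have "height n 0 * prob (base n 0) + height n 1 * prob (base n 1) + height n 2 * prob (base n 2) = 1"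
    using tower_mass[of n] by (simp add: eval_nat_numeral)
  ultimately have "ht (n + 1) * (prob (J n) - prob (J (n + 1))) + ht (n + 2) * (prob (J (n + 1)) - prob (J (n + 2)))
      + (real (ht (n + 2)) - ht n) * prob (J (n + 2)) = 1"
    by (simp add: height_def base_def prob_D)
  then show ?thesis by (simp add: pairing_def algebra_simps)
qed

text \<open>Invariance applied to the identity function gives \<open>T x - x\<close> mean 0;
  \<open>g\<close> is this displacement written on the three branches.\<close>

lemma pairing_len_prob: "pairing len (\<lambda>n. prob (J n)) 0 = 0"
proof -
  define g where "g x = \<alpha> * indicator (D 0) x + \<beta> * indicator (D 1) x + (\<beta> - 1) * indicator (J 2) x" for x :: real
  have id: "integrable M (\<lambda>x. x)"
    by (rule integrable_const_bound[of _ 1]) (use support in auto)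
  have "integrable M T" using integrable_funpow[OF id, of 1] by simp
  moreover have "(\<integral>x. T x \<partial>M) = (\<integral>x. x \<partial>M)" using integral_funpow[of "\<lambda>x. x" 1] by simp
  ultimately have "(\<integral>x. T x - x \<partial>M) = 0"
    by (subst Bochner_Integration.integral_diff[OF _ id]) linarith+
  moreover have "(\<integral>x. T x - x \<partial>M) = (\<integral>x. g x \<partial>M)"
  proof (rule integral_cong_AE)
    show "AE x in M. T x - x = g x"
      using support
    proof eventually_elim
      case (elim x)
      have "\<beta> < \<alpha>" "0 < \<beta>" "\<alpha> < 1" using b_less_a[of 0] b_pos[of 0] a_less_1[of 0] by (auto simp: a_0 b_0)
      then show ?case using elim len_1 len_2
        by (auto simp: g_def itm_def D_def J_def numeral_2_eq_2 indicator_def)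
    qed
  qed (auto simp: g_def)
  moreover have "(\<integral>x. g x \<partial>M) = \<alpha> * prob (D 0) + \<beta> * prob (D 1) + (\<beta> - 1) * prob (J 2)"
    unfolding g_def by (simp add: integrable_indicator_borel)
  ultimately show ?thesis
    using len_1 len_2 by (simp add: prob_D pairing_def numeral_2_eq_2 algebra_simps)
qed

end

locale bounded_invariant_distribution =
  bounded_type_itm \<alpha> \<beta> K G + invariant_distribution \<alpha> \<beta> M for \<alpha> \<beta> K G M
begin

lemma frequency_prob: "frequency (\<lambda>n. prob (J n))"
  unfolding frequency_def
proof (intro conjI allI)
  show "prob (J (Suc n)) \<le> prob (J n)" for n
    by (rule finite_measure_mono) (simp_all add: J_antimono)
qed (rule measure_nonneg pairing_prob pairing_len_prob)+

end

section \<open>Characteristic functions and unique ergodicity\<close>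

lemma iexp_Lipschitz: "cmod (iexp x - iexp y) \<le> \<bar>x - y\<bar>"
proof -
  have "iexp x - iexp y = iexp y * (iexp (x - y) - 1)"
    by (simp add: algebra_simps flip: exp_add)
  moreover have "cmod (iexp (x - y) - 1) \<le> \<bar>x - y\<bar>"
    using iexp_approx1[of "x - y" 0] by simp
  ultimately show ?thesis by (simp add: norm_mult)
qed

context invariant_distribution
begin

text \<open>Every level of a tower is a translate of its base, of diameter at most
  \<open>len n\<close>, so the exponential is nearly constant on it; the errors are weighted by
  total mass 1. The approximating sum depends on \<open>M\<close> only through the masses of the
  bases, since the \<open>SOME\<close> representatives do not involve \<open>M\<close>.\<close>

lemma char_approx:
  "cmod (char M t - (\<Sum>j<3. prob (base n j) *\<^sub>R (\<Sum>i<height n j. iexp (t * (T ^^ i) (SOME y. y \<in> base n j)))))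
     \<le> \<bar>t\<bar> * len n"
proof -
  define y where "y j = (SOME y. y \<in> base n j)" for j
  have y: "y j \<in> base n j" for j
  proof -
    have "\<exists>y. y \<in> base n j"
      using len_pos[of "n + 2"] len_less[of n] len_less[of "n + 1"]
      by (auto simp: base_def D_def J_def intro: exI[of _ "1 - len n"] exI[of _ "1 - len (Suc n)"])
    then show ?thesis unfolding y_def by (rule someI_ex)
  qed
  have int: "integrable M (\<lambda>x. iexp (t * x))"
    by (rule integrable_const_bound[of _ 1]) auto
  have int': "integrable M (\<lambda>x. indicator (base n j) x *\<^sub>R iexp (t * (T ^^ i) x))" for i j
    by (rule integrable_const_bound[of _ 1]) (auto simp: indicator_def)
  have int'': "integrable M (\<lambda>x. indicator (base n j) x *\<^sub>R c)" for j and c :: complex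
    by (rule integrable_const_bound[of _ "cmod c"]) (auto simp: indicator_def)
  have const: "(\<integral>x. indicator (base n j) x *\<^sub>R c \<partial>M) = prob (base n j) *\<^sub>R c" for j and c :: complex
    by (simp add: integrable_indicator_borel)
  have level: "cmod ((\<integral>x. indicator (base n j) x *\<^sub>R iexp (t * (T ^^ i) x) \<partial>M) - prob (base n j) *\<^sub>R iexp (t * (T ^^ i) (y j)))
      \<le> prob (base n j) * (\<bar>t\<bar> * len n)" if i: "i < height n j" for i j
  proof -
    have eq: "(\<integral>x. indicator (base n j) x *\<^sub>R iexp (t * (T ^^ i) x) \<partial>M) - prob (base n j) *\<^sub>R iexp (t * (T ^^ i) (y j))
      = (\<integral>x. indicator (base n j) x *\<^sub>R iexp (t * (T ^^ i) x) - indicator (base n j) x *\<^sub>R iexp (t * (T ^^ i) (y j)) \<partial>M)"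
      by (subst Bochner_Integration.integral_diff[OF int' int'']) (simp only: const)
    have "cmod (\<integral>x. indicator (base n j) x *\<^sub>R iexp (t * (T ^^ i) x) - indicator (base n j) x *\<^sub>R iexp (t * (T ^^ i) (y j)) \<partial>M)
      \<le> (\<integral>x. indicator (base n j) x * (\<bar>t\<bar> * len n) \<partial>M)"
    proof (rule Bochner_Integration.integral_norm_bound_integral[OF Bochner_Integration.integrable_diff[OF int' int'']])
      fix x
      have "cmod (iexp (t * (T ^^ i) x) - iexp (t * (T ^^ i) (y j))) \<le> \<bar>t\<bar> * len n" if x: "x \<in> base n j"
      proof -
        have "cmod (iexp (t * (T ^^ i) x) - iexp (t * (T ^^ i) (y j))) \<le> \<bar>t * (T ^^ i) x - t * (T ^^ i) (y j)\<bar>"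
          by (rule iexp_Lipschitz)
        also have "\<dots> = \<bar>t\<bar> * \<bar>(T ^^ i) x - (T ^^ i) (y j)\<bar>" by (simp flip: right_diff_distrib add: abs_mult)
        also have "\<dots> \<le> \<bar>t\<bar> * len n"
          using base_translation[OF x y, of i] i base_diam[OF x y] by (intro mult_left_mono) auto
        finally show ?thesis .
      qed
      then show "cmod (indicator (base n j) x *\<^sub>R iexp (t * (T ^^ i) x) - indicator (base n j) x *\<^sub>R iexp (t * (T ^^ i) (y j)))
        \<le> indicator (base n j) x * (\<bar>t\<bar> * len n)" by (auto simp: indicator_def)
    qed (simp add: integrable_indicator_borel)
    also have "\<dots> = prob (base n j) * (\<bar>t\<bar> * len n)" by (simp add: integrable_indicator_borel)
    finally show ?thesis unfolding eq .
  qed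
  define err where "err i j = (\<integral>x. indicator (base n j) x *\<^sub>R iexp (t * (T ^^ i) x) \<partial>M) - prob (base n j) *\<^sub>R iexp (t * (T ^^ i) (y j))" for i j
  have eq: "char M t - (\<Sum>j<3. prob (base n j) *\<^sub>R (\<Sum>i<height n j. iexp (t * (T ^^ i) (y j)))) =
    (\<Sum>j<3. \<Sum>i<height n j. err i j)"
    unfolding char_def Kac[OF int, of n] err_def by (simp only: sum_subtractf scaleR_sum_right)
  have "cmod (\<Sum>j<3. \<Sum>i<height n j. err i j) \<le> (\<Sum>j<3. \<Sum>i<height n j. prob (base n j) * (\<bar>t\<bar> * len n))"
    unfolding err_def by (intro sum_norm_le level) auto
  also have "\<dots> = (\<Sum>j<3. height n j * prob (base n j)) * (\<bar>t\<bar> * len n)"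
    by (simp add: sum_distrib_right mult.assoc)
  also have "\<dots> = \<bar>t\<bar> * len n" by (simp only: tower_mass mult_1)
  finally show ?thesis unfolding eq[symmetric] y_def .
qed

end

context bounded_type_itm
begin

theorem uniquely_ergodic:
  assumes "invariant_distribution \<alpha> \<beta> M" and "invariant_distribution \<alpha> \<beta> M'"
  shows "M = M'"
proof -
  interpret M: bounded_invariant_distribution \<alpha> \<beta> K G M
    using assms(1) bounded_type_itm_axioms by (simp add: bounded_invariant_distribution_def)
  interpret M': bounded_invariant_distribution \<alpha> \<beta> K G M'
    using assms(2) bounded_type_itm_axioms by (simp add: bounded_invariant_distribution_def)
  have J: "measure M (J n) = measure M' (J n)" for n
    using frequency_unique[OF M.frequency_prob M'.frequency_prob] by meson
  then have base: "measure M (base n j) = measure M' (base n j)" for n j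
    by (simp add: base_def M.prob_D M'.prob_D)
  have "cmod (char M t - char M' t) \<le> 2 * \<bar>t\<bar> * len n" for t n
  proof -
    have "cmod (x - y) \<le> 2 * e" if "cmod (x - z) \<le> e" "cmod (y - z) \<le> e" for x y z e
      using norm_triangle_ineq4[of "x - z" "y - z"] that by simp
    from this[OF M.char_approx[of t n, unfolded base] M'.char_approx[of t n]]
    show ?thesis by simp
  qed
  then have "cmod (char M t - char M' t) \<le> 0" for t
  proof (intro LIMSEQ_le_const)
    show "(\<lambda>n. 2 * \<bar>t\<bar> * len n) \<longlonglongrightarrow> 0" using tendsto_mult_right_zero[OF len_tendsto_0] .
  qed auto
  then have "char M = char M'" by (intro ext) simp
  then show ?thesis
    by (rule Levy_uniqueness[OF M.real_distribution_axioms M'.real_distribution_axioms])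
qed

end

section \<open>Ergodicity and eigenvalues\<close>

text \<open>For an indicator, outer regularity of both \<open>A\<close> and its complement gives
  open sets \<open>U\<close> and \<open>V\<close> covering them with small overlap. A Urysohn
  function that is 0 off \<open>U\<close> and 1 off \<open>V\<close> differs from the indicator only
  on that overlap.\<close>

lemma continuous_dense_L1:
  fixes M :: "'a :: euclidean_space measure" and f :: "'a \<Rightarrow> 'b :: {banach, second_countable_topology}"
  assumes fin: "finite_measure M" and sets: "sets M = sets borel" and f: "integrable M f" and "0 < \<epsilon>"
  shows "\<exists>g. continuous_on UNIV g \<and> integrable M g \<and> (\<integral>x. norm (f x - g x) \<partial>M) < \<epsilon>"
proof -
  interpret finite_measure M by (rule fin)
  show ?thesis using f \<open>0 < \<epsilon>\<close>
  proof (induction arbitrary: \<epsilon> rule: integrable_induct)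
    case (base A c)
    have space: "space M = UNIV" using sets_eq_imp_space_eq[OF sets] by simp
    \<comment> \<open>The overlap has measure at most \<open>2 * d\<close>; the summand 1 covers
      \<open>c = 0\<close> and makes the final estimate strict.\<close>
    define d where "d = \<epsilon> / (2 * (norm c + 1))"
    have d: "0 < d" using \<open>0 < \<epsilon>\<close> by (simp add: d_def add_nonneg_pos)
    have open_cover: "\<exists>U. open U \<and> B \<subseteq> U \<and> measure M U < measure M B + d" if "B \<in> sets borel" for B
    proof -
      have fin: "emeasure M (space M) \<noteq> \<infinity>" by (simp add: emeasure_eq_measure)
      have "emeasure M B < emeasure M B + ennreal d" using d by (simp add: emeasure_eq_measure ennreal_less_iff flip: ennreal_plus)
      then have "(INF U \<in> {U. B \<subseteq> U \<and> open U}. emeasure M U) < emeasure M B + ennreal d"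
        using outer_regular[OF sets fin that] by simp
      then obtain U where "B \<subseteq> U" "open U" "emeasure M U < emeasure M B + ennreal d"
        by (auto simp: INF_less_iff)
      then show ?thesis using d
        by (auto simp: emeasure_eq_measure ennreal_less_iff simp flip: ennreal_plus)
    qed
    have A: "A \<in> sets borel" "- A \<in> sets borel" using base by (auto simp: sets)
    obtain U where U: "open U" "A \<subseteq> U" "measure M U < measure M A + d" using open_cover[OF A(1)] by blast
    obtain V where V: "open V" "- A \<subseteq> V" "measure M V < measure M (- A) + d" using open_cover[OF A(2)] by blast
    have UV: "U \<in> sets M" "V \<in> sets M" "A \<in> sets M" using U V A by (auto simp: sets)
    have "measure M (U \<inter> V) + measure M (U \<union> V) = measure M U + measure M V"
      using measure_Un3[OF fmeasurable_eq_sets[THEN equalityD2, THEN subsetD, OF UV(1)] fmeasurable_eq_sets[THEN equalityD2, THEN subsetD, OF UV(2)]]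
      by simp
    moreover have "U \<union> V = space M" using U V space by auto
    moreover have "measure M (- A) = measure M (space M) - measure M A"
      using finite_measure_compl[OF UV(3)] by (simp add: space Compl_eq_Diff_UNIV)
    ultimately have UV_small: "measure M (U \<inter> V) \<le> 2 * d" using U V by simp
    obtain h :: "'a \<Rightarrow> real" where h: "continuous_on UNIV h" "\<And>x. h x \<in> closed_segment 0 1"
      "\<And>x. x \<in> - U \<Longrightarrow> h x = 0" "\<And>x. x \<in> - V \<Longrightarrow> h x = 1"
      by (rule Urysohn[of "- U" "- V" "0::real" 1]) (use U V in auto)
    have h01: "0 \<le> h x" "h x \<le> 1" for x using h(2)[of x] by (auto simp: closed_segment_eq_real_ivl)
    have [measurable]: "h \<in> borel_measurable M"
      using borel_measurable_continuous_onI[OF h(1)] measurable_cong_sets[OF sets refl] by blast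
    have int_h: "integrable M (\<lambda>x. h x *\<^sub>R c)"
      by (rule integrable_const_bound[of _ "norm c"]) (use h01 in \<open>auto simp: mult_left_le_one_le\<close>)
    have int_A: "integrable M (\<lambda>x. indicator A x *\<^sub>R c)"
      by (rule integrable_const_bound[of _ "norm c"]) (use UV in \<open>auto simp: indicator_def\<close>)
    have int_UV: "integrable M (\<lambda>x. indicator (U \<inter> V) x * norm c)"
      by (rule integrable_const_bound[of _ "norm c"]) (use UV in \<open>auto simp: indicator_def\<close>)
    have "(\<integral>x. norm (indicator A x *\<^sub>R c - h x *\<^sub>R c) \<partial>M) \<le> (\<integral>x. indicator (U \<inter> V) x * norm c \<partial>M)"
    proof (rule integral_mono[OF integrable_norm[OF Bochner_Integration.integrable_diff[OF int_A int_h]] int_UV])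
      fix x
      have "\<bar>indicator A x - h x\<bar> \<le> indicator (U \<inter> V) x"
        using h01[of x] h(3,4)[of x] U(2) V(2) by (auto simp: indicator_def)
      then have "\<bar>indicator A x - h x\<bar> * norm c \<le> indicator (U \<inter> V) x * norm c" by (rule mult_right_mono) simp
      then show "norm (indicator A x *\<^sub>R c - h x *\<^sub>R c) \<le> indicator (U \<inter> V) x * norm c"
        by (simp flip: scaleR_left_diff_distrib)
    qed
    also have "\<dots> = measure M (U \<inter> V) * norm c" using UV by simp
    also have "\<dots> \<le> 2 * d * norm c" using UV_small by (rule mult_right_mono) simp
    also have "\<dots> = \<epsilon> * (norm c / (norm c + 1))"
      using norm_ge_zero[of c] by (simp add: d_def divide_simps)
    also have "\<dots> < \<epsilon> * 1"
      using \<open>0 < \<epsilon>\<close> norm_ge_zero[of c]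
      by (intro mult_strict_left_mono) (auto simp: divide_less_eq_1_pos add_nonneg_pos)
    finally have "(\<integral>x. norm (indicator A x *\<^sub>R c - h x *\<^sub>R c) \<partial>M) < \<epsilon>" by simp
    then show ?case using h(1) int_h
      by (intro exI[of _ "\<lambda>x. h x *\<^sub>R c"]) (auto intro!: continuous_intros)
  next
    case (add f1 f2)
    obtain g1 where g1: "continuous_on UNIV g1" "integrable M g1" "(\<integral>x. norm (f1 x - g1 x) \<partial>M) < \<epsilon> / 2"
      using add.IH(1)[of "\<epsilon> / 2"] add.prems by auto
    obtain g2 where g2: "continuous_on UNIV g2" "integrable M g2" "(\<integral>x. norm (f2 x - g2 x) \<partial>M) < \<epsilon> / 2"
      using add.IH(2)[of "\<epsilon> / 2"] add.prems by auto
    have "(\<integral>x. norm ((f1 x + f2 x) - (g1 x + g2 x)) \<partial>M) \<le> (\<integral>x. norm (f1 x - g1 x) + norm (f2 x - g2 x) \<partial>M)"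
    proof (rule integral_mono)
      show "norm ((f1 x + f2 x) - (g1 x + g2 x)) \<le> norm (f1 x - g1 x) + norm (f2 x - g2 x)" for x
        by (rule norm_diff_triangle_ineq)
    qed (use g1 g2 add.hyps in auto)
    also have "\<dots> < \<epsilon>" using g1 g2 add.hyps by simp
    finally show ?case using g1 g2
      by (intro exI[of _ "\<lambda>x. g1 x + g2 x"]) (auto intro!: continuous_intros)
  next
    case (lim f s)
    have "(\<lambda>i. \<integral>x. norm (f x - s i x) \<partial>M) \<longlonglongrightarrow> (\<integral>x. 0 \<partial>M)"
    proof (rule integral_dominated_convergence)
      show "integrable M (\<lambda>x. 3 * norm (f x))" using lim.hyps by simp
      show "AE x in M. (\<lambda>i. norm (f x - s i x)) \<longlonglongrightarrow> 0"
      proof (rule AE_I2)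
        fix x assume "x \<in> space M"
        then have "(\<lambda>i. norm (f x - s i x)) \<longlonglongrightarrow> norm (f x - f x)" by (intro tendsto_intros lim.hyps)
        then show "(\<lambda>i. norm (f x - s i x)) \<longlonglongrightarrow> 0" by simp
      qed
      fix i show "AE x in M. norm (norm (f x - s i x)) \<le> 3 * norm (f x)"
      proof (rule AE_I2)
        fix x assume "x \<in> space M"
        then have "norm (s i x) \<le> 2 * norm (f x)" by (rule lim.hyps)
        then show "norm (norm (f x - s i x)) \<le> 3 * norm (f x)"
          using norm_triangle_ineq4[of "f x" "s i x"] by simp
      qed
    qed (use lim.hyps in auto)
    then have "\<forall>\<^sub>F i in sequentially. (\<integral>x. norm (f x - s i x) \<partial>M) < \<epsilon> / 2"
      using lim.prems by (intro order_tendstoD(2)[of _ "\<integral>x. 0 \<partial>M"]) auto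
    then obtain i where i: "(\<integral>x. norm (f x - s i x) \<partial>M) < \<epsilon> / 2"
      by (meson eventually_happens sequentially_bot)
    obtain g where g: "continuous_on UNIV g" "integrable M g" "(\<integral>x. norm (s i x - g x) \<partial>M) < \<epsilon> / 2"
      using lim.IH[of "\<epsilon> / 2" i] lim.prems by auto
    have "(\<integral>x. norm (f x - g x) \<partial>M) \<le> (\<integral>x. norm (f x - s i x) + norm (s i x - g x) \<partial>M)"
    proof (rule integral_mono)
      show "norm (f x - g x) \<le> norm (f x - s i x) + norm (s i x - g x)" for x
        using norm_triangle_ineq[of "f x - s i x" "s i x - g x"] by simp
    qed (use g lim.hyps in auto)
    also have "\<dots> < \<epsilon>" using i g lim.hyps by simp
    finally show ?case using g by blast
  qed
qed

context bounded_invariant_distribution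
begin

text \<open>Conditioning on an invariant set of positive mass gives another invariant distribution,
  which by uniqueness is \<open>M\<close> itself.\<close>

lemma ergodic:
  assumes A [measurable]: "A \<in> sets borel" and inv: "AE x in M. T x \<in> A \<longleftrightarrow> x \<in> A" and pos: "prob A \<noteq> 0"
  shows "prob A = 1"
proof -
  define M' where "M' = uniform_measure M A"
  have A': "emeasure M A \<noteq> 0" "emeasure M A \<noteq> \<infinity>" using pos by (auto simp: emeasure_eq_measure)
  interpret M': prob_space M' unfolding M'_def by (rule prob_space_uniform_measure[OF A'])
  have sets: "sets M' = sets borel" by (simp add: M'_def)
  have "invariant_distribution \<alpha> \<beta> M'"
  proof
    show "distr M' borel T = M'"
    proof (rule measure_eqI)
      fix B assume "B \<in> sets (distr M' borel T)"
      then have [measurable]: "B \<in> sets borel" by simp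
      have pre [measurable]: "T -` C \<in> sets borel" if "C \<in> sets borel" for C
        using measurable_sets[OF itm_measurable that] by simp
      have "emeasure M (A \<inter> T -` B) = emeasure M (T -` A \<inter> T -` B)"
        using inv by (intro emeasure_eq_AE) auto
      also have "\<dots> = emeasure (distr M borel T) (A \<inter> B)"
        by (subst emeasure_distr) auto
      finally have *: "emeasure M (A \<inter> T -` B) = emeasure M (A \<inter> B)" using invariant by simp
      have "emeasure (distr M' borel T) B = emeasure M' (T -` B)"
        by (subst emeasure_distr) (auto simp: M'_def)
      also have "\<dots> = emeasure M' B" unfolding M'_def by (simp add: *)
      finally show "emeasure (distr M' borel T) B = emeasure M' B" .
    qed (simp add: sets)
    show "AE x in M'. x \<in> {0..1}"
      unfolding M'_def by (rule AE_uniform_measureI) (use support in auto)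
  qed (auto simp: sets)
  then have "M' = M"
    by (rule uniquely_ergodic) (rule invariant_distribution_axioms)
  moreover have "measure M' A = 1"
    using pos A' by (simp add: M'_def)
  ultimately show ?thesis by simp
qed

text \<open>Cutting at the mean suffices: whether the set where \<open>f\<close> exceeds
  \<open>m\<close> is null or full, \<open>f - m\<close> has one sign and integral 0.\<close>

lemma invariant_imp_const:
  fixes f :: "real \<Rightarrow> real"
  assumes f: "integrable M f" and inv: "AE x in M. f (T x) = f x"
  shows "\<exists>z. AE x in M. f x = z"
proof -
  define m where "m = expectation f"
  have [measurable]: "f \<in> borel_measurable borel" using borel_measurable_integrable[OF f] by simp
  define A where "A = {x. m < f x}"
  have [measurable]: "A \<in> sets borel" by (simp add: A_def)
  have "AE x in M. T x \<in> A \<longleftrightarrow> x \<in> A" using inv by eventually_elim (simp add: A_def)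
  then consider "prob A = 0" | "prob A = 1" using ergodic[of A] by auto
  then have "AE x in M. f x - m = 0"
  proof cases
    case 1
    then have "AE x in M. x \<notin> A" by (simp add: prob_eq_0)
    then have "AE x in M. 0 \<le> m - f x" by eventually_elim (simp add: A_def)
    moreover have "expectation (\<lambda>x. m - f x) = 0" using f prob_space by (simp add: m_def)
    ultimately have "AE x in M. m - f x = 0"
      using integral_nonneg_eq_0_iff_AE[of M "\<lambda>x. m - f x"] f by simp
    then show ?thesis by eventually_elim simp
  next
    case 2
    then have "AE x in M. x \<in> A" by (simp add: prob_eq_1)
    then have "AE x in M. 0 \<le> f x - m" by eventually_elim (simp add: A_def)
    moreover have "expectation (\<lambda>x. f x - m) = 0" using f prob_space by (simp add: m_def)
    ultimately show ?thesis
      using integral_nonneg_eq_0_iff_AE[of M "\<lambda>x. f x - m"] f by simp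
  qed
  then show ?thesis by (intro exI[of _ m]) simp
qed

text \<open>Of the Kac formula only the tower over \<open>J (m + 2)\<close> is kept, with its base
  cut down to \<open>D (m + 2)\<close>.\<close>

lemma tower_integral_le:
  fixes F :: "real \<Rightarrow> real"
  assumes F: "integrable M F" and nonneg: "\<And>x. 0 \<le> F x"
  shows "(\<Sum>i<hs m. \<integral>x. indicator (D (m + 2)) x * F ((T ^^ i) x) \<partial>M) \<le> (\<integral>x. F x \<partial>M)"
proof -
  have int: "integrable M (\<lambda>x. indicator A x * F ((T ^^ i) x))" if "A \<in> sets borel" for A i
    using integrable_mult_indicator[of A M "\<lambda>x. F ((T ^^ i) x)"] integrable_funpow[OF F, of i] that by simp
  have "(\<Sum>i<hs m. \<integral>x. indicator (D (m + 2)) x * F ((T ^^ i) x) \<partial>M)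
      \<le> (\<Sum>i<hs m. \<integral>x. indicator (J (m + 2)) x * F ((T ^^ i) x) \<partial>M)"
    using J_Suc[of "m + 2"] nonneg
    by (intro sum_mono integral_mono int) (auto simp: indicator_def)
  also have "\<dots> = (\<Sum>i<height m 2. \<integral>x. indicator (base m 2) x *\<^sub>R F ((T ^^ i) x) \<partial>M)"
    by (simp add: height_def base_def)
  also have "\<dots> \<le> (\<Sum>j<3. \<Sum>i<height m j. \<integral>x. indicator (base m j) x *\<^sub>R F ((T ^^ i) x) \<partial>M)"
    using nonneg
    by (intro member_le_sum sum_nonneg integral_nonneg_AE) auto
  finally show ?thesis by (simp only: Kac[OF F, of m])
qed

text \<open>With \<open>p = ht (m + 3)\<close>, the map \<open>T ^^ p\<close> shifts
  \<open>D (m + 2)\<close> by \<open>len (m + 3)\<close> inside \<open>J (m + 2)\<close>, where the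
  first \<open>hs m\<close> iterates are rigid. Hence every level of the tower over
  \<open>D (m + 2)\<close> is shifted by the same tiny amount: a continuous approximation of
  \<open>f\<close> hardly changes, while \<open>f\<close> is multiplied by \<open>c ^ p\<close>. As
  the tower keeps a fixed share of the mass, \<open>c ^ p\<close> must be close to 1.\<close>

lemma eigenvalue_powers:
  fixes f :: "real \<Rightarrow> complex"
  assumes f: "integrable M f" and eig: "AE x in M. f (T x) = c * f x"
    and c: "cmod c = 1" and C: "0 < C" "AE x in M. cmod (f x) = C"
  shows "(\<lambda>n. c ^ ht n) \<longlonglongrightarrow> 1"
proof (rule LIMSEQ_I)
  fix \<epsilon> :: real assume "0 < \<epsilon>"
  define \<delta> where "\<delta> = 1 / (real K + 1) ^ (4 * G + 6)"
  have \<delta>: "0 < \<delta>" by (simp add: \<delta>_def add_nonneg_pos)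
  \<comment> \<open>Three errors of size \<open>e\<close> will arise, and
    \<open>3 * e < \<delta> * C * \<epsilon>\<close>.\<close>
  define e where "e = \<epsilon> * C * \<delta> / 4"
  have e: "0 < e" using \<open>0 < \<epsilon>\<close> C \<delta> by (simp add: e_def)
  obtain g where g: "continuous_on UNIV g" "integrable M g" "(\<integral>x. cmod (f x - g x) \<partial>M) < e"
    using continuous_dense_L1[OF finite_measure_axioms events_eq_borel f e] by blast
  define F where "F x = cmod (f x - g x)" for x
  have F: "integrable M F" "\<And>x. 0 \<le> F x" "(\<integral>x. F x \<partial>M) < e"
    using f g by (auto simp: F_def[abs_def])
  have "uniformly_continuous_on {0..1} g"
    by (rule compact_uniformly_continuous[OF continuous_on_subset[OF g(1)]]) auto
  then obtain d where d: "0 < d"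
    "\<And>x y. x \<in> {0..1} \<Longrightarrow> y \<in> {0..1} \<Longrightarrow> \<bar>x - y\<bar> < d \<Longrightarrow> cmod (g x - g y) < e"
    using e unfolding uniformly_continuous_on_def dist_norm real_norm_def by metis
  obtain N where N: "\<And>n. n \<ge> N \<Longrightarrow> len n < d"
    using order_tendstoD(2)[OF len_tendsto_0 d(1)] by (auto simp: eventually_sequentially)
  have iter: "AE x in M. f ((T ^^ n) x) = c ^ n * f x" for n
  proof (induction n)
    case (Suc n)
    show ?case using Suc AE_funpow[OF eig, of n] by eventually_elim simp
  qed simp
  have main: "cmod (c ^ ht (m + 3) - 1) < \<epsilon>" if m: "2 * G < m" "N \<le> m" for m
  proof -
    define p where "p = ht (m + 3)"
    define z where "z = cmod (c ^ p - 1)"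
    have F': "integrable M (\<lambda>x. F ((T ^^ p) x))" "(\<integral>x. F ((T ^^ p) x) \<partial>M) < e"
      using integrable_funpow[OF F(1), of p] integral_funpow[of F p] F borel_measurable_integrable[OF F(1)]
      by simp_all
    have near: "cmod (g ((T ^^ p) ((T ^^ i) x)) - g ((T ^^ i) x)) < e" if x: "x \<in> D (m + 2)" and i: "i < hs m" for x i
    proof -
      have J: "D (m + 2) \<subseteq> J (m + 2)" using J_Suc by blast
      have px: "(T ^^ p) x = x + len (m + 3)" using returns_D[of "m + 2"] x
        by (simp add: returns_def p_def numeral_3_eq_3)
      have "(T ^^ p) x \<in> J (m + 2)"
        unfolding px using x len_pos[of "m + 3"] by (simp add: D_def J_def numeral_3_eq_3)
      then have "(T ^^ i) ((T ^^ p) x) - (T ^^ i) x = (T ^^ p) x - x"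
        using returns_J[of m] x J i by (auto simp: returns_def)
      moreover have "(T ^^ i) ((T ^^ p) x) = (T ^^ p) ((T ^^ i) x)"
        by (metis add.commute comp_apply funpow_add)
      ultimately have "\<bar>(T ^^ p) ((T ^^ i) x) - (T ^^ i) x\<bar> < d"
        using px N[of "m + 3"] m len_pos[of "m + 3"] by simp
      moreover have "(T ^^ i) x \<in> {0..1}" using x J J_subset by (intro funpow_itm_in) blast
      ultimately show ?thesis by (intro d(2)) (auto simp del: atLeastAtMost_iff intro: funpow_itm_in)
    qed
    have int: "integrable M (\<lambda>x. indicator (D (m + 2)) x * H ((T ^^ i) x))" if "integrable M H" for H :: "real \<Rightarrow> real" and i
      using integrable_mult_indicator[of "D (m + 2)" M "\<lambda>x. H ((T ^^ i) x)"] integrable_funpow[OF that, of i] by simp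
    have level: "prob (D (m + 2)) * (z * C) \<le> (\<integral>x. indicator (D (m + 2)) x * F ((T ^^ p) ((T ^^ i) x)) \<partial>M)
        + (\<integral>x. indicator (D (m + 2)) x * F ((T ^^ i) x) \<partial>M) + prob (D (m + 2)) * e" if i: "i < hs m" for i
    proof -
      have "prob (D (m + 2)) * (z * C) = (\<integral>x. indicator (D (m + 2)) x * (z * C) \<partial>M)"
        by (simp add: integrable_indicator_borel)
      also have "\<dots> \<le> (\<integral>x. indicator (D (m + 2)) x * F ((T ^^ p) ((T ^^ i) x)) + indicator (D (m + 2)) x * F ((T ^^ i) x) + indicator (D (m + 2)) x * e \<partial>M)"
      proof (rule integral_mono_AE)
        show "AE x in M. indicator (D (m + 2)) x * (z * C) \<le> indicator (D (m + 2)) x * F ((T ^^ p) ((T ^^ i) x)) + indicator (D (m + 2)) x * F ((T ^^ i) x) + indicator (D (m + 2)) x * e"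
          using iter[of "p + i"] iter[of i] C(2)
        proof eventually_elim
          case (elim x)
          show ?case
          proof (cases "x \<in> D (m + 2)")
            case True
            have "(T ^^ (p + i)) x = (T ^^ p) ((T ^^ i) x)" by (simp only: funpow_add comp_apply)
            then have "f ((T ^^ p) ((T ^^ i) x)) - f ((T ^^ i) x) = (c ^ p - 1) * (c ^ i * f x)"
              using elim by (simp only: power_add) (simp add: algebra_simps)
            then have "z * C = cmod (f ((T ^^ p) ((T ^^ i) x)) - f ((T ^^ i) x))"
              using elim c by (simp add: norm_mult norm_power z_def)
            also have "\<dots> \<le> F ((T ^^ p) ((T ^^ i) x)) + F ((T ^^ i) x) + cmod (g ((T ^^ p) ((T ^^ i) x)) - g ((T ^^ i) x))"
              unfolding F_def
              using norm_triangle_ineq[of "f ((T ^^ p) ((T ^^ i) x)) - g ((T ^^ p) ((T ^^ i) x)) - (f ((T ^^ i) x) - g ((T ^^ i) x))" "g ((T ^^ p) ((T ^^ i) x)) - g ((T ^^ i) x)"]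
                norm_triangle_ineq4[of "f ((T ^^ p) ((T ^^ i) x)) - g ((T ^^ p) ((T ^^ i) x))" "f ((T ^^ i) x) - g ((T ^^ i) x)"]
              by simp
            also have "\<dots> \<le> F ((T ^^ p) ((T ^^ i) x)) + F ((T ^^ i) x) + e"
              using near[OF True i] by simp
            finally show ?thesis using True by simp
          qed simp
        qed
        show "integrable M (\<lambda>x. indicator (D (m + 2)) x * F ((T ^^ p) ((T ^^ i) x)) + indicator (D (m + 2)) x * F ((T ^^ i) x) + indicator (D (m + 2)) x * e)"
          using int[OF F'(1), of i] int[OF F(1), of i] by (simp add: integrable_indicator_borel)
      qed (simp add: integrable_indicator_borel)
      also have "\<dots> = (\<integral>x. indicator (D (m + 2)) x * F ((T ^^ p) ((T ^^ i) x)) \<partial>M)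
        + (\<integral>x. indicator (D (m + 2)) x * F ((T ^^ i) x) \<partial>M) + prob (D (m + 2)) * e"
        using int[OF F'(1), of i] int[OF F(1), of i] by (simp add: integrable_indicator_borel)
      finally show ?thesis .
    qed
    have mass: "hs m * prob (D (m + 2)) \<le> 1"
      using tower_integral_le[of "\<lambda>_. 1" m] prob_space by simp
    have "hs m * prob (D (m + 2)) * (z * C) = (\<Sum>i<hs m. prob (D (m + 2)) * (z * C))" by simp
    also have "\<dots> \<le> (\<Sum>i<hs m. (\<integral>x. indicator (D (m + 2)) x * F ((T ^^ p) ((T ^^ i) x)) \<partial>M)
        + (\<integral>x. indicator (D (m + 2)) x * F ((T ^^ i) x) \<partial>M) + prob (D (m + 2)) * e)"
      by (intro sum_mono level) simp
    also have "\<dots> = (\<Sum>i<hs m. \<integral>x. indicator (D (m + 2)) x * F ((T ^^ p) ((T ^^ i) x)) \<partial>M)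
        + (\<Sum>i<hs m. \<integral>x. indicator (D (m + 2)) x * F ((T ^^ i) x) \<partial>M) + hs m * prob (D (m + 2)) * e"
      by (simp add: sum.distrib)
    also have "\<dots> \<le> e + e + 1 * e"
      using tower_integral_le[OF F'(1), of m] tower_integral_le[OF F(1,2), of m] F F' e
        mult_right_mono[OF mass, of e]
      by (intro add_mono) auto
    finally have "hs m * prob (D (m + 2)) * (z * C) \<le> 3 * e" by simp
    moreover have "\<delta> \<le> hs m * prob (D (m + 2))"
      using tower_mass_lower[OF frequency_prob m(1)] unfolding \<delta>_def prob_D by (simp add: numeral_3_eq_3)
    then have "\<delta> * (z * C) \<le> hs m * prob (D (m + 2)) * (z * C)"
      using C by (intro mult_right_mono) (auto simp: z_def)
    ultimately have "(\<delta> * C) * z < (\<delta> * C) * \<epsilon>" using e by (simp add: e_def mult_ac)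
    then show ?thesis using \<delta> C by (simp add: z_def p_def)
  qed
  show "\<exists>n0. \<forall>n\<ge>n0. cmod (c ^ ht n - 1) < \<epsilon>"
  proof (intro exI[of _ "2 * G + N + 4"] allI impI)
    fix n assume "2 * G + N + 4 \<le> n"
    then show "cmod (c ^ ht n - 1) < \<epsilon>" using main[of "n - 3"] by simp
  qed
qed

theorem eigenfunction_trivial:
  fixes f :: "real \<Rightarrow> complex"
  assumes [measurable]: "f \<in> borel_measurable borel" and sq: "integrable M (\<lambda>x. (cmod (f x))\<^sup>2)"
    and eig: "AE x in M. f (T x) = c * f x" and nz: "\<not> (AE x in M. f x = 0)"
  shows "c = 1 \<and> (\<exists>z. AE x in M. f x = z)"
proof -
  have f: "integrable M f"
  proof (rule Bochner_Integration.integrable_bound)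
    show "integrable M (\<lambda>x. 1 + (cmod (f x))\<^sup>2)" using sq by simp
    have "cmod (f x) \<le> 1 + (cmod (f x))\<^sup>2" for x
      using sum_squares_bound[of 1 "cmod (f x)"] by simp (smt (verit) zero_le_power2 norm_ge_zero)
    then show "AE x in M. cmod (f x) \<le> norm (1 + (cmod (f x))\<^sup>2)" by simp
  qed simp
  have "(\<integral>x. (cmod (f x))\<^sup>2 \<partial>M) = (\<integral>x. (cmod (f (T x)))\<^sup>2 \<partial>M)"
    using integral_funpow[of "\<lambda>x. (cmod (f x))\<^sup>2" 1] by simp
  also have "\<dots> = (\<integral>x. (cmod c)\<^sup>2 * (cmod (f x))\<^sup>2 \<partial>M)"
    by (rule integral_cong_AE) (use eig in \<open>auto simp: norm_mult power_mult_distrib elim!: AE_mp\<close>)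
  finally have "(1 - (cmod c)\<^sup>2) * (\<integral>x. (cmod (f x))\<^sup>2 \<partial>M) = 0" by (simp add: algebra_simps)
  moreover have "(\<integral>x. (cmod (f x))\<^sup>2 \<partial>M) \<noteq> 0"
    using nz integral_nonneg_eq_0_iff_AE[OF sq] by simp
  ultimately have "(cmod c)\<^sup>2 = 1" by simp
  then have c: "cmod c = 1" by (simp add: power2_eq_1_iff) (smt (verit) norm_ge_zero)
  have "AE x in M. cmod (f (T x)) = cmod (f x)"
    using eig by eventually_elim (simp add: norm_mult c)
  then obtain C where C: "AE x in M. cmod (f x) = C"
    using invariant_imp_const[of "\<lambda>x. cmod (f x)"] f by auto
  have "0 < C"
  proof (rule ccontr)
    assume "\<not> 0 < C"
    have "AE x in M. f x = 0"
      using C by eventually_elim (use \<open>\<not> 0 < C\<close> in \<open>metis norm_ge_zero norm_eq_zero less_eq_real_def\<close>)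
    then show False using nz by simp
  qed
  then have lim: "(\<lambda>n. c ^ ht n) \<longlonglongrightarrow> 1" by (rule eigenvalue_powers[OF f eig c _ C])
  define \<theta> where "\<theta> = Arg c / (2 * pi)"
  have cis_c: "c = cis (2 * pi * \<theta>)"
    using c by (simp add: \<theta>_def cis_Arg) (metis cis_Arg c norm_zero sgn_eq div_by_1 of_real_1 zero_neq_one)
  \<comment> \<open>The principal argument measures the signed distance of
    \<open>\<theta> * ht n\<close> to an integer in turns. It is continuous at 1, so convergence of
    the powers becomes convergence of these distances to 0.\<close>
  have "\<exists>w :: int. \<theta> * ht n - w = Arg (c ^ ht n) / (2 * pi)" for n
  proof -
    have "cis (2 * pi * \<theta> * ht n) = c ^ ht n"
      using Complex.DeMoivre[of "2 * pi * \<theta>" "ht n"] unfolding cis_c[symmetric] by (simp only: mult.commute)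
    also have "\<dots> = cis (Arg (c ^ ht n))"
      using cis_Arg[of "c ^ ht n"] c by (simp add: norm_power sgn_eq) (metis norm_power norm_zero power_one zero_neq_one)
    finally have "sin (2 * pi * \<theta> * ht n) = sin (Arg (c ^ ht n)) \<and> cos (2 * pi * \<theta> * ht n) = cos (Arg (c ^ ht n))"
      by (auto simp: complex_eq_iff)
    then obtain w :: int where "2 * pi * \<theta> * ht n = Arg (c ^ ht n) + 2 * pi * w"
      unfolding sin_cos_eq_iff by blast
    then have "\<theta> * ht n - w = Arg (c ^ ht n) / (2 * pi)" by (simp add: field_simps)
    then show ?thesis ..
  qed
  then obtain w :: "nat \<Rightarrow> int" where w: "\<And>n. \<theta> * ht n - w n = Arg (c ^ ht n) / (2 * pi)" by metis
  have "(\<lambda>n. Arg (c ^ ht n)) \<longlonglongrightarrow> Arg 1"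
    by (rule isCont_tendsto_compose[OF continuous_at_Arg lim]) simp
  then have "(\<lambda>n. Arg (c ^ ht n) / (2 * pi)) \<longlonglongrightarrow> 0 / (2 * pi)"
    by (intro tendsto_intros) simp_all
  then have "(\<lambda>n. \<theta> * ht n - w n) \<longlonglongrightarrow> 0" unfolding w by simp
  then have "\<theta> \<in> \<int>" by (rule near_integer_multiples)
  then have "c = 1" unfolding cis_c by (auto elim!: Ints_cases)
  then have inv: "AE x in M. f (T x) = f x" using eig by simp
  have "AE x in M. Re (f (T x)) = Re (f x)" "AE x in M. Im (f (T x)) = Im (f x)"
    using inv by (eventually_elim, simp)+
  then obtain u v where "AE x in M. Re (f x) = u" "AE x in M. Im (f x) = v"
    using invariant_imp_const[of "\<lambda>x. Re (f x)"] invariant_imp_const[of "\<lambda>x. Im (f x)"] f by auto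
  then have "AE x in M. f x = Complex u v" by eventually_elim (simp add: complex_eq_iff)
  then show ?thesis using \<open>c = 1\<close> by blast
qed

end

section \<open>Existence of an invariant measure\<close>

context infinite_type_itm
begin

lemma funpow_image_antimono: "m \<le> n \<Longrightarrow> (T ^^ n) ` {0..1} \<subseteq> (T ^^ m) ` {0..1}"
proof -
  assume "m \<le> n"
  then obtain k where k: "n = m + k" using le_Suc_ex by blast
  have "(T ^^ n) x \<in> (T ^^ m) ` {0..1}" if "x \<in> {0..1}" for x
    using funpow_itm_in[OF that, of k] unfolding k funpow_add comp_apply by (rule imageI)
  then show ?thesis by blast
qed

text \<open>\<open>T ^^ hs n\<close> maps the left end of \<open>J (n + 2)\<close> to that of
  \<open>J n\<close>, so a longer history is bought by raising the index \<open>n\<close>, which is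
  therefore left free in the induction.\<close>

lemma left_endpoint_preimage: "\<exists>i\<ge>m. \<exists>x\<in>{0..1}. (T ^^ i) x = 1 - len n"
proof (induction m arbitrary: n)
  case 0
  show ?case using len_antimono[of 0 n] len_pos[of n]
    by (intro exI[of _ 0] conjI bexI[of _ "1 - len n"]) auto
next
  case (Suc m)
  obtain i x where i: "i \<ge> m" "x \<in> {0..1}" "(T ^^ i) x = 1 - len (n + 2)" using Suc.IH[of "n + 2"] by blast
  have "1 - len (n + 2) \<in> J (n + 2)" using len_pos[of "n + 2"] by (simp add: J_def)
  then have "(T ^^ hs n) (1 - len (n + 2)) = 1 - len n"
    using returns_J[of n] by (simp add: returns_def)
  then have "(T ^^ (hs n + i)) x = 1 - len n" using i by (simp add: funpow_add)
  then show ?case using i hs_pos[of n] by (intro exI[of _ "hs n + i"] conjI bexI[of _ x]) auto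
qed

lemma left_endpoint_in_image: "1 - len n \<in> (T ^^ m) ` {0..1}"
  using left_endpoint_preimage[of m n] funpow_image_antimono[of m] by (metis image_eqI subsetD)

abbreviation (input) "\<Omega> \<equiv> attractor \<alpha> \<beta>"

lemma attractor_subset: "\<Omega> \<subseteq> {0..1}"
proof -
  have "\<Omega> \<subseteq> closure ((T ^^ 0) ` {0..1})" unfolding attractor_def by blast
  then show ?thesis by simp
qed

lemma attractor_closed: "closed \<Omega>"
  unfolding attractor_def by auto

lemma isCont_itm: "x \<noteq> 1 - \<alpha> \<Longrightarrow> x \<noteq> 1 - \<beta> \<Longrightarrow> isCont T x"
proof -
  assume x: "x \<noteq> 1 - \<alpha>" "x \<noteq> 1 - \<beta>"
  have ab: "\<beta> < \<alpha>" using b_less_a[of 0] by (simp add: a_0 b_0)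
  consider "x < 1 - \<alpha>" | "1 - \<alpha> < x" "x < 1 - \<beta>" | "1 - \<beta> < x" using x by linarith
  then have "\<exists>S v. open S \<and> x \<in> S \<and> (\<forall>y\<in>S. T y = y + v)"
  proof cases
    case 1 then show ?thesis
      by (intro exI[of _ "{..<1 - \<alpha>}"] exI[of _ \<alpha>]) (auto simp: itm_def)
  next
    case 2 then show ?thesis
      by (intro exI[of _ "{1 - \<alpha><..<1 - \<beta>}"] exI[of _ \<beta>]) (auto simp: itm_def)
  next
    case 3 then show ?thesis using ab
      by (intro exI[of _ "{1 - \<beta><..}"] exI[of _ "\<beta> - 1"]) (auto simp: itm_def)
  qed
  then obtain S v where S: "open S" "x \<in> S" "\<And>y. y \<in> S \<Longrightarrow> T y = y + v" by blast
  have "continuous_on S T \<longleftrightarrow> continuous_on S (\<lambda>y. y + v)" by (intro continuous_on_cong refl S(3))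
  then have "continuous_on S T" by (simp add: continuous_intros)
  then show ?thesis using continuous_on_eq_continuous_at[OF S(1)] S(2) by blast
qed

text \<open>The discontinuities are left endpoints of the intervals \<open>J 1\<close> and \<open>J 2\<close>, so they lie in
  every image of \<open>T\<close>, not only in the closures.\<close>

lemma attractor_invariant:
  assumes x: "x \<in> \<Omega>"
  shows "T x \<in> \<Omega>"
  unfolding attractor_def
proof
  fix n
  show "T x \<in> closure ((T ^^ n) ` {0..1})"
  proof (cases "x = 1 - \<alpha> \<or> x = 1 - \<beta>")
    case True
    then have "x \<in> (T ^^ n) ` {0..1}"
      using left_endpoint_in_image[of 1 n] left_endpoint_in_image[of 2 n] len_1 len_2 by auto
    then have "T x \<in> (T ^^ Suc n) ` {0..1}" by auto
    then have "T x \<in> (T ^^ n) ` {0..1}"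
      using funpow_image_antimono[of n "Suc n"] by (rule subsetD[rotated]) simp
    then show ?thesis by (rule closure_subset[THEN subsetD])
  next
    case False
    then have "isCont T x" using isCont_itm by blast
    have "x \<in> closure ((T ^^ n) ` {0..1})" using x by (auto simp: attractor_def)
    then obtain s where s: "\<And>i. s i \<in> (T ^^ n) ` {0..1}" "s \<longlonglongrightarrow> x"
      by (auto simp: closure_sequential)
    have "T (s i) \<in> (T ^^ Suc n) ` {0..1}" for i using s(1)[of i] by auto
    then have "T (s i) \<in> (T ^^ n) ` {0..1}" for i
      using funpow_image_antimono[of n "Suc n"] by (meson le_SucI order_refl subsetD)
    moreover have "(\<lambda>i. T (s i)) \<longlonglongrightarrow> T x" by (rule isCont_tendsto_compose[OF \<open>isCont T x\<close> s(2)])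
    ultimately show ?thesis
      unfolding closure_sequential by (intro exI[of _ "\<lambda>i. T (s i)"]) simp
  qed
qed

lemma funpow_displacement:
  "\<exists>p q r :: nat. p + q + r = n \<and> (T ^^ n) x = x + p * \<alpha> + q * \<beta> + r * (\<beta> - 1)"
proof (induction n)
  case 0 show ?case by simp
next
  case (Suc n)
  then obtain p q r :: nat where pqr: "p + q + r = n" "(T ^^ n) x = x + p * \<alpha> + q * \<beta> + r * (\<beta> - 1)" by blast
  define y where "y = (T ^^ n) x"
  have Suc_n: "(T ^^ Suc n) x = T y" by (simp add: y_def)
  have "T y = y + \<alpha> \<or> T y = y + \<beta> \<or> T y = y + (\<beta> - 1)" by (simp add: itm_def)
  then consider "T y = y + \<alpha>" | "T y = y + \<beta>" | "T y = y + (\<beta> - 1)" by blast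
  then show ?case
  proof cases
    case 1
    show ?thesis unfolding Suc_n 1
      by (rule exI[of _ "Suc p"], rule exI[of _ q], rule exI[of _ r]) (use pqr in \<open>simp add: y_def algebra_simps\<close>)
  next
    case 2
    show ?thesis unfolding Suc_n 2
      by (rule exI[of _ p], rule exI[of _ "Suc q"], rule exI[of _ r]) (use pqr in \<open>simp add: y_def algebra_simps\<close>)
  next
    case 3
    show ?thesis unfolding Suc_n 3
      by (rule exI[of _ p], rule exI[of _ q], rule exI[of _ "Suc r"]) (use pqr in \<open>simp add: y_def algebra_simps\<close>)
  qed
qed

end

section \<open>Aperiodicity, orbit averages and their weak limits\<close>

context bounded_type_itm
begin

text \<open>By \<open>funpow_displacement\<close> only finitely many displacements occur before time
  \<open>m\<close>, and \<open>rationally_independent\<close> makes each of them nonzero.\<close>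

lemma uniformly_aperiodic:
  "\<exists>\<delta>>0. \<forall>x. \<forall>n. 0 < n \<and> n < m \<longrightarrow> \<delta> \<le> \<bar>(T ^^ n) x - x\<bar>"
proof -
  define S where "S = (\<lambda>(p, q, r). \<bar>real p * \<alpha> + real q * \<beta> + real r * (\<beta> - 1)\<bar>) `
    ({..m} \<times> {..m} \<times> {..m} - {(0, 0, 0)})"
  have fin: "finite S" by (simp add: S_def)
  have pos: "0 < s" if "s \<in> S" for s
  proof -
    from that obtain z where z: "z \<in> {..m} \<times> {..m} \<times> {..m} - {(0, 0, 0)}"
      and s_eq: "s = (\<lambda>(p, q, r). \<bar>real p * \<alpha> + real q * \<beta> + real r * (\<beta> - 1)\<bar>) z"
      unfolding S_def by (rule imageE)
    obtain p q r :: nat where pqr: "z = (p, q, r)" by (rule prod_cases3)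
    have s: "s = \<bar>real p * \<alpha> + real q * \<beta> + real r * (\<beta> - 1)\<bar>" "(p, q, r) \<noteq> (0, 0, 0)"
      using z unfolding s_eq pqr by simp_all
    have "s \<noteq> 0"
    proof
      assume "s = 0"
      then have "real_of_int (- int r) + real_of_int (int p) * \<alpha> + real_of_int (int q + int r) * \<beta> = 0"
        using s by (simp add: algebra_simps)
      then have "- int r = 0 \<and> int p = 0 \<and> int q + int r = 0" by (rule rationally_independent)
      then show False using s by simp
    qed
    then show ?thesis using s by simp
  qed
  \<comment> \<open>\<open>insert 1\<close> covers \<open>m = 0\<close>, where \<open>S\<close> is
    empty.\<close>
  define \<delta> where "\<delta> = Min (insert 1 S)"
  show ?thesis
  proof (intro exI[of _ \<delta>] conjI allI impI)
    show "0 < \<delta>" using fin pos by (auto simp: \<delta>_def)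
    fix x n assume n: "0 < n \<and> n < m"
    obtain p q r :: nat where pqr: "p + q + r = n" "(T ^^ n) x = x + p * \<alpha> + q * \<beta> + r * (\<beta> - 1)"
      using funpow_displacement by blast
    then have "\<bar>(T ^^ n) x - x\<bar> = \<bar>real p * \<alpha> + real q * \<beta> + real r * (\<beta> - 1)\<bar>" by simp
    also have "\<dots> \<in> S" unfolding S_def using pqr n by (intro image_eqI[of _ _ "(p, q, r)"]) auto
    finally show "\<delta> \<le> \<bar>(T ^^ n) x - x\<bar>" using fin by (simp add: \<delta>_def)
  qed
qed

definition empirical :: "nat \<Rightarrow> real measure" where
  "empirical n = distr (measure_pmf (pmf_of_set {..n})) borel (\<lambda>i. (T ^^ i) 0)"

lemma real_distribution_empirical: "real_distribution (empirical n)"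
  unfolding empirical_def by (rule prob_space.real_distribution_distr) (auto intro: prob_space_measure_pmf)

lemma integral_empirical:
  fixes g :: "real \<Rightarrow> 'b :: {banach, second_countable_topology}"
  assumes "g \<in> borel_measurable borel"
  shows "(\<integral>x. g x \<partial>empirical n) = (\<Sum>i\<le>n. g ((T ^^ i) 0)) /\<^sub>R Suc n"
proof -
  have "(\<integral>x. g x \<partial>empirical n) = (\<integral>i. g ((T ^^ i) 0) \<partial>measure_pmf (pmf_of_set {..n}))"
    unfolding empirical_def using assms by (subst integral_distr) auto
  also have "\<dots> = (\<Sum>i\<le>n. pmf (pmf_of_set {..n}) i *\<^sub>R g ((T ^^ i) 0))"
    by (rule integral_measure_pmf) auto
  also have "\<dots> = (\<Sum>i\<le>n. g ((T ^^ i) 0)) /\<^sub>R Suc n"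
    unfolding scaleR_sum_right by (intro sum.cong) (auto simp: divide_inverse)
  finally show ?thesis .
qed

lemma tight_empirical: "tight empirical"
  unfolding tight_def
proof (intro conjI allI impI)
  show "real_distribution (empirical n)" for n by (rule real_distribution_empirical)
  fix \<epsilon> :: real assume "0 < \<epsilon>"
  have "measure (empirical n) {-1<..1} = 1" for n
  proof -
    interpret real_distribution "empirical n" by (rule real_distribution_empirical)
    have "(T ^^ i) 0 \<in> {0..1}" for i by (rule funpow_itm_in) simp
    then have "AE x in empirical n. x \<in> {-1<..1}"
      unfolding empirical_def by (subst AE_distr_iff) (auto intro!: AE_I2, smt (verit))
    then show ?thesis by (simp add: prob_eq_1)
  qed
  then show "\<exists>a b. a < b \<and> (\<forall>n. 1 - \<epsilon> < measure (empirical n) {a<..b})"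
    using \<open>0 < \<epsilon>\<close> by (intro exI[of _ "-1"] exI[of _ 1]) simp
qed

text \<open>The sums telescope for every bounded Borel function, so iterates of the discontinuous
  map can be removed before passing to a weak limit.\<close>

lemma empirical_shift:
  fixes g :: "real \<Rightarrow> 'b :: {banach, second_countable_topology}"
  assumes g: "g \<in> borel_measurable borel" and bound: "\<And>x. norm (g x) \<le> B"
  shows "(\<lambda>n. (\<integral>x. g ((T ^^ j) x) \<partial>empirical n) - (\<integral>x. g x \<partial>empirical n)) \<longlonglongrightarrow> 0"
proof (induction j)
  case 0 show ?case by simp
next
  case (Suc j)
  have "(\<lambda>n. (\<integral>x. g ((T ^^ Suc j) x) \<partial>empirical n) - (\<integral>x. g ((T ^^ j) x) \<partial>empirical n)) \<longlonglongrightarrow> 0"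
  proof (rule Lim_null_comparison)
    have "norm ((\<integral>x. g ((T ^^ Suc j) x) \<partial>empirical n) - (\<integral>x. g ((T ^^ j) x) \<partial>empirical n)) \<le> 2 * B / Suc n" for n
    proof -
      have "(\<integral>x. g ((T ^^ Suc j) x) \<partial>empirical n) - (\<integral>x. g ((T ^^ j) x) \<partial>empirical n)
        = ((\<Sum>i\<le>n. g ((T ^^ (j + Suc i)) 0)) - (\<Sum>i\<le>n. g ((T ^^ (j + i)) 0))) /\<^sub>R Suc n"
        using g by (simp add: integral_empirical scaleR_diff_right funpow_add funpow_swap1 del: of_nat_Suc)
      also have "(\<Sum>i\<le>n. g ((T ^^ (j + Suc i)) 0)) - (\<Sum>i\<le>n. g ((T ^^ (j + i)) 0)) = g ((T ^^ (j + Suc n)) 0) - g ((T ^^ j) 0)"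
        by (induction n) (simp_all add: algebra_simps)
      finally have "norm ((\<integral>x. g ((T ^^ Suc j) x) \<partial>empirical n) - (\<integral>x. g ((T ^^ j) x) \<partial>empirical n))
        = norm (g ((T ^^ (j + Suc n)) 0) - g ((T ^^ j) 0)) / Suc n" by (simp add: divide_inverse)
      also have "\<dots> \<le> 2 * B / Suc n"
        using norm_triangle_ineq4[of "g ((T ^^ (j + Suc n)) 0)" "g ((T ^^ j) 0)"] bound[of "(T ^^ (j + Suc n)) 0"] bound[of "(T ^^ j) 0"]
        by (intro divide_right_mono) auto
      finally show ?thesis .
    qed
    then show "\<forall>\<^sub>F n in sequentially. norm ((\<integral>x. g ((T ^^ Suc j) x) \<partial>empirical n) - (\<integral>x. g ((T ^^ j) x) \<partial>empirical n)) \<le> 2 * B / Suc n"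
      by simp
    show "(\<lambda>n. 2 * B / Suc n) \<longlonglongrightarrow> 0"
      using tendsto_mult_right_zero[OF LIMSEQ_Suc[OF lim_inverse_n], of "2 * B"] by (simp add: divide_inverse)
  qed
  from tendsto_add[OF this Suc] show ?case by simp
qed

text \<open>Weak convergence extends to bounded integrands whose discontinuities are null for the
  limit, so invariance follows once the limit has no atom at the break points of \<open>T\<close>.
  Atoms are excluded because an orbit meets a short enough interval at most once in \<open>m\<close>
  consecutive steps, for every \<open>m\<close>.\<close>

lemma limit_of_empirical:
  assumes r: "strict_mono r" and M: "real_distribution M" and conv: "weak_conv_m (empirical \<circ> r) M"
  shows limit_invariant: "invariant_distribution \<alpha> \<beta> M"
    and limit_attractor: "AE x in M. x \<in> \<Omega>"
proof -
  interpret real_distribution M by (rule M)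
  have lim: "(\<lambda>n. \<integral>x. f x \<partial>empirical (r n)) \<longlonglongrightarrow> (\<integral>x. f x \<partial>M)"
    if "emeasure M {x. \<not> isCont f x} = 0" "\<And>x. norm (f x) \<le> B" "f \<in> borel_measurable borel"
    for f :: "real \<Rightarrow> 'b :: {banach, second_countable_topology}" and B
    using weak_conv_imp_bdd_ae_continuous_conv[OF _ M conv that(1,2,3)] real_distribution_empirical
    by (simp add: comp_def)
  have lim_cont: "(\<lambda>n. \<integral>x. f x \<partial>empirical (r n)) \<longlonglongrightarrow> (\<integral>x. f x \<partial>M)"
    if "continuous_on UNIV f" "\<And>x. norm (f x) \<le> B"
    for f :: "real \<Rightarrow> 'b :: {banach, second_countable_topology}" and B
  proof (rule lim[OF _ that(2)])
    show "emeasure M {x. \<not> isCont f x} = 0" using that(1) by (simp add: continuous_on_eq_continuous_at)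
  qed (rule borel_measurable_continuous_onI[OF that(1)])
  have shift: "(\<lambda>n. \<integral>x. f ((T ^^ j) x) \<partial>empirical (r n)) \<longlonglongrightarrow> l"
    if "(\<lambda>n. \<integral>x. f x \<partial>empirical (r n)) \<longlonglongrightarrow> l" "\<And>x. norm (f x) \<le> B" "f \<in> borel_measurable borel"
    for f :: "real \<Rightarrow> 'b :: {banach, second_countable_topology}" and B l j
    using tendsto_add[OF LIMSEQ_subseq_LIMSEQ[OF empirical_shift[OF that(3,2), of j] r] that(1)]
    by (simp add: comp_def)
  have atomless: "prob {p} = 0" for p
  proof -
    have bound: "real m * prob {p} \<le> 1" for m
    proof -
      obtain \<delta> where \<delta>: "0 < \<delta>" "\<And>x n. 0 < n \<Longrightarrow> n < m \<Longrightarrow> \<delta> \<le> \<bar>(T ^^ n) x - x\<bar>"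
        using uniformly_aperiodic[of m] by blast
      \<comment> \<open>A tent vanishing outside an interval of length \<open>\<delta>\<close>: two
        points where it is nonzero are too close to be fewer than \<open>m\<close> steps apart on
        one orbit.\<close>
      define g where "g x = max 0 (1 - 2 / \<delta> * \<bar>x - p\<bar>)" for x
      have g: "0 \<le> g x" "g x \<le> 1" "norm (g x) \<le> 1" for x using \<delta> by (auto simp: g_def)
      have g_cont: "continuous_on UNIV g" unfolding g_def[abs_def] by (intro continuous_intros)
      have g_meas [measurable]: "g \<in> borel_measurable borel" by (rule borel_measurable_continuous_onI[OF g_cont])
      have supp: "\<bar>x - p\<bar> < \<delta> / 2" if "g x \<noteq> 0" for x
        using that \<delta> by (auto simp: g_def max_def field_simps split: if_splits)
      have once: "(\<Sum>j<m. g ((T ^^ j) x)) \<le> 1" for x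
      proof (cases "\<exists>i<m. g ((T ^^ i) x) \<noteq> 0")
        case True
        then obtain i where i: "i < m" "g ((T ^^ i) x) \<noteq> 0" by blast
        have le: "i' \<le> j'" if "i' < m" "g ((T ^^ i') x) \<noteq> 0" "g ((T ^^ j') x) \<noteq> 0" for i' j'
        proof (rule ccontr)
          assume "\<not> i' \<le> j'"
          then obtain k where k: "i' = k + j'" "0 < k" by (metis add.commute le_Suc_ex less_imp_le_nat not_le zero_less_diff add_diff_cancel_right')
          have "\<delta> \<le> \<bar>(T ^^ k) ((T ^^ j') x) - (T ^^ j') x\<bar>" by (rule \<delta>(2)) (use k that in auto)
          then show False using supp[OF that(2)] supp[OF that(3)] unfolding k funpow_add comp_apply by linarith
        qed
        have "(\<Sum>j<m. g ((T ^^ j) x)) = (\<Sum>j<m. if j = i then g ((T ^^ i) x) else 0)"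
          using le i by (intro sum.cong refl) (auto intro: order_antisym)
        also have "\<dots> = g ((T ^^ i) x)" using i by simp
        finally show ?thesis using g by simp
      qed (simp add: sum.neutral)
      have "(\<lambda>n. \<Sum>j<m. \<integral>x. g ((T ^^ j) x) \<partial>empirical (r n)) \<longlonglongrightarrow> (\<Sum>j<m. \<integral>x. g x \<partial>M)"
        by (intro tendsto_sum shift[OF lim_cont[OF g_cont g(3)] g(3)] g_meas)
      moreover have "(\<Sum>j<m. \<integral>x. g ((T ^^ j) x) \<partial>empirical n) \<le> 1" for n
      proof -
        interpret e: real_distribution "empirical n" by (rule real_distribution_empirical)
        have int: "integrable (empirical n) (\<lambda>x. g ((T ^^ j) x))" for j
          by (rule e.integrable_const_bound[of _ 1]) (use g in auto)
        have "(\<Sum>j<m. \<integral>x. g ((T ^^ j) x) \<partial>empirical n) = (\<integral>x. (\<Sum>j<m. g ((T ^^ j) x)) \<partial>empirical n)"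
          by (simp add: int)
        also have "\<dots> \<le> (\<integral>x. 1 \<partial>empirical n)" using once int by (intro integral_mono) auto
        finally show ?thesis using e.prob_space by simp
      qed
      ultimately have "(\<Sum>j<m. \<integral>x. g x \<partial>M) \<le> 1" by (intro LIMSEQ_le_const2) auto
      then have "real m * (\<integral>x. g x \<partial>M) \<le> 1" by simp
      moreover have "prob {p} \<le> (\<integral>x. g x \<partial>M)"
      proof -
        have "(\<integral>x. indicator {p} x \<partial>M) \<le> (\<integral>x. g x \<partial>M)"
        proof (rule integral_mono)
          show "integrable M (indicator {p} :: real \<Rightarrow> real)" by (rule integrable_const_bound[of _ 1]) auto
          show "integrable M g" by (rule integrable_const_bound[of _ 1]) (use g in auto)
          show "indicator {p} x \<le> g x" for x using g by (auto simp: indicator_def g_def)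
        qed
        then show ?thesis by simp
      qed
      ultimately show ?thesis by (meson mult_left_mono of_nat_0_le_iff order_trans)
    qed
    show ?thesis
    proof (rule ccontr)
      assume "prob {p} \<noteq> 0"
      then have "0 < prob {p}" by (simp add: zero_less_measure_iff)
      then obtain m where "1 < real m * prob {p}" using reals_Archimedean3 by blast
      then show False using bound[of m] by simp
    qed
  qed
  have closure: "AE x in M. x \<in> closure ((T ^^ m) ` {0..1})" for m
  proof -
    define C where "C = closure ((T ^^ m) ` {0..1})"
    have C: "closed C" "C \<noteq> {}" by (auto simp: C_def)
    \<comment> \<open>The truncated distance is bounded and continuous and vanishes exactly on
      \<open>C\<close>; composed with \<open>T ^^ m\<close> it vanishes along the whole orbit of
      0.\<close>
    define g where "g x = min 1 (infdist x C)" for x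
    have g: "0 \<le> g x" "norm (g x) \<le> 1" for x using infdist_nonneg[of x C] by (auto simp: g_def)
    have g_cont: "continuous_on UNIV g" unfolding g_def[abs_def] by (intro continuous_intros)
    have g_meas [measurable]: "g \<in> borel_measurable borel" by (rule borel_measurable_continuous_onI[OF g_cont])
    have "(\<lambda>n. \<integral>x. g ((T ^^ m) x) \<partial>empirical (r n)) \<longlonglongrightarrow> (\<integral>x. g x \<partial>M)"
      by (rule shift[OF lim_cont[OF g_cont g(2)] g(2) g_meas])
    moreover have "(\<integral>x. g ((T ^^ m) x) \<partial>empirical n) = 0" for n
    proof -
      have "g ((T ^^ m) ((T ^^ i) 0)) = 0" for i
      proof -
        have "(T ^^ m) ((T ^^ i) 0) \<in> (T ^^ m) ` {0..1}" by (intro imageI funpow_itm_in) simp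
        then have "(T ^^ m) ((T ^^ i) 0) \<in> C" unfolding C_def by (rule closure_subset[THEN subsetD])
        then show ?thesis by (simp add: g_def)
      qed
      then show ?thesis by (simp add: integral_empirical)
    qed
    ultimately have "(\<integral>x. g x \<partial>M) = 0" by (simp add: LIMSEQ_const_iff)
    moreover have "integrable M g" by (rule integrable_const_bound[of _ 1]) (use g in auto)
    ultimately have "AE x in M. g x = 0" using g by (simp add: integral_nonneg_eq_0_iff_AE)
    then show ?thesis
      unfolding C_def[symmetric]
    proof eventually_elim
      case (elim x)
      then have "infdist x C = 0" using infdist_nonneg[of x C] by (simp add: g_def min_def split: if_splits)
      then show ?case using in_closed_iff_infdist_zero[OF C] by simp
    qed
  qed
  then show attr: "AE x in M. x \<in> \<Omega>"
    unfolding attractor_def by (simp add: AE_all_countable)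
  show "invariant_distribution \<alpha> \<beta> M"
  proof
    show "AE x in M. x \<in> {0..1}" using attr by eventually_elim (use attractor_subset in blast)
    have "char (distr M borel T) = char M"
    proof
      fix t
      have null: "emeasure M {x. \<not> isCont (\<lambda>x. iexp (t * T x)) x} = 0"
      proof -
        have "{x. \<not> isCont (\<lambda>x. iexp (t * T x)) x} \<subseteq> {1 - \<alpha>} \<union> {1 - \<beta>}"
          using isCont_itm by (auto intro!: continuous_intros)
        then have "emeasure M {x. \<not> isCont (\<lambda>x. iexp (t * T x)) x} \<le> emeasure M ({1 - \<alpha>} \<union> {1 - \<beta>})"
          by (intro emeasure_mono) auto
        also have "\<dots> \<le> emeasure M {1 - \<alpha>} + emeasure M {1 - \<beta>}" by (rule emeasure_subadditive) auto
        also have "\<dots> = 0" by (simp add: emeasure_eq_measure atomless)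
        finally show ?thesis by simp
      qed
      have "(\<lambda>n. \<integral>x. iexp (t * T x) \<partial>empirical (r n)) \<longlonglongrightarrow> (\<integral>x. iexp (t * T x) \<partial>M)"
        by (rule lim[OF null, of 1]) auto
      moreover have "(\<lambda>n. \<integral>x. iexp (t * x) \<partial>empirical (r n)) \<longlonglongrightarrow> (\<integral>x. iexp (t * x) \<partial>M)"
        by (rule lim_cont[of _ 1]) (auto intro!: continuous_intros)
      then have "(\<lambda>n. \<integral>x. iexp (t * (T ^^ 1) x) \<partial>empirical (r n)) \<longlonglongrightarrow> (\<integral>x. iexp (t * x) \<partial>M)"
        by (rule shift[of "\<lambda>x. iexp (t * x)" _ 1 1]) auto
      ultimately have "(\<integral>x. iexp (t * T x) \<partial>M) = (\<integral>x. iexp (t * x) \<partial>M)"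
        by (intro LIMSEQ_unique) simp_all
      then show "char (distr M borel T) t = char M t"
        unfolding char_def by (subst integral_distr) auto
    qed
    then show "distr M borel T = M"
      by (intro Levy_uniqueness real_distribution_distr M) auto
  qed
qed

lemma exists_invariant_distribution:
  obtains M where "invariant_distribution \<alpha> \<beta> M" "AE x in M. x \<in> \<Omega>"
proof -
  obtain r M where "strict_mono r" "real_distribution M" "weak_conv_m (empirical \<circ> id \<circ> r) M"
    using tight_imp_convergent_subsubsequence[OF tight_empirical strict_mono_id] by blast
  then have "strict_mono r" "real_distribution M" "weak_conv_m (empirical \<circ> r) M" by simp_all
  note limit = limit_of_empirical[OF this]
  show thesis by (rule that[OF limit])
qed

text \<open>\<open>M\<close> gives the attractor full mass and \<open>T\<close> maps the attractor
  into itself, so the distribution on the line restricts to the trace of the Borel sets.\<close>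

lemma exists_invariant_prob: "\<exists>\<mu>. invariant_prob \<alpha> \<beta> \<mu>"
proof -
  obtain M where "invariant_distribution \<alpha> \<beta> M" and attr: "AE x in M. x \<in> \<Omega>"
    by (rule exists_invariant_distribution)
  interpret invariant_distribution \<alpha> \<beta> M by fact
  have \<Omega> [measurable]: "\<Omega> \<in> sets borel" by (rule borel_closed[OF attractor_closed])
  define \<mu> where "\<mu> = restrict_space M \<Omega>"
  have em: "emeasure \<mu> A = emeasure M A" if "A \<in> sets \<mu>" for A
    using that unfolding \<mu>_def by (intro emeasure_restrict_space) (auto simp: sets_restrict_space)
  have space: "space \<mu> = \<Omega>" by (simp add: \<mu>_def space_restrict_space)
  have sets: "sets \<mu> = sets (restrict_space borel \<Omega>)"
    unfolding \<mu>_def by (rule sets_restrict_space_cong) simp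
  have prob: "prob_space \<mu>"
  proof
    have "emeasure M \<Omega> = 1" using attr by (simp add: emeasure_eq_1_AE)
    then show "emeasure \<mu> (space \<mu>) = 1" using em[OF sets.top] by (simp add: space)
  qed
  have meas: "T \<in> measurable \<mu> \<mu>"
    unfolding measurable_cong_sets[OF sets sets]
    by (intro measurable_restrict_space2 measurable_restrict_space1)
      (auto simp: space_restrict_space attractor_invariant)
  have "distr \<mu> \<mu> T = \<mu>"
  proof (rule measure_eqI)
    fix A assume "A \<in> sets (distr \<mu> \<mu> T)"
    then have A: "A \<in> sets \<mu>" by simp
    then have A' [measurable]: "A \<in> sets borel" "A \<subseteq> \<Omega>"
      using \<Omega> by (auto simp: sets sets_restrict_space)
    have pre: "T -` A \<inter> space \<mu> \<in> sets \<mu>" using measurable_sets[OF meas A] .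
    have "emeasure (distr \<mu> \<mu> T) A = emeasure M (T -` A \<inter> \<Omega>)"
      using em[OF pre] by (simp add: emeasure_distr[OF meas A] space)
    also have "\<dots> = emeasure M (T -` A)"
      using attr measurable_sets[OF itm_measurable A'(1)] by (intro emeasure_eq_AE) auto
    also have "\<dots> = emeasure (distr M borel T) A" by (subst emeasure_distr) auto
    also have "\<dots> = emeasure \<mu> A" by (simp add: invariant em[OF A])
    finally show "emeasure (distr \<mu> \<mu> T) A = emeasure \<mu> A" .
  qed simp
  then show ?thesis using prob sets meas by (auto simp: invariant_prob_def)
qed

lemma invariant_prob_weakly_mixing:
  assumes "invariant_prob \<alpha> \<beta> \<mu>"
  shows "weakly_mixing T \<mu>"
proof -
  have \<Omega> [measurable]: "\<Omega> \<in> sets borel" by (rule borel_closed[OF attractor_closed])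
  interpret \<mu>: prob_space \<mu> using assms by (simp add: invariant_prob_def)
  have sets: "sets \<mu> = sets (restrict_space borel \<Omega>)" and meas: "T \<in> measurable \<mu> \<mu>" and inv: "distr \<mu> \<mu> T = \<mu>"
    using assms by (auto simp: invariant_prob_def)
  have space: "space \<mu> = \<Omega>" using sets_eq_imp_space_eq[OF sets] by (simp add: space_restrict_space)
  have id [measurable]: "(\<lambda>x. x) \<in> borel_measurable \<mu>"
    unfolding measurable_cong_sets[OF sets refl] by (intro measurable_restrict_space1) simp
  define M where "M = distr \<mu> borel (\<lambda>x. x)"
  have AE_M: "(AE x in M. P x) \<longleftrightarrow> (AE x in \<mu>. P x)" if "Measurable.pred borel P" for P
    unfolding M_def using that by (subst AE_distr_iff) auto
  have "invariant_distribution \<alpha> \<beta> M"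
  proof (intro invariant_distribution.intro invariant_distribution_axioms.intro)
    show "real_distribution M" unfolding M_def by (rule \<mu>.real_distribution_distr) simp
    have "distr M borel T = distr \<mu> borel T" unfolding M_def by (subst distr_distr) (auto simp: comp_def)
    also have "\<dots> = distr (distr \<mu> \<mu> T) borel (\<lambda>x. x)" by (subst distr_distr[OF id meas]) (simp add: comp_def)
    finally show "distr M borel T = M" by (simp add: inv M_def)
    show "AE x in M. x \<in> {0..1}" using space attractor_subset by (subst AE_M) (auto intro!: AE_I2)
  qed unfold_locales
  interpret bounded_invariant_distribution \<alpha> \<beta> K G M
    using \<open>invariant_distribution \<alpha> \<beta> M\<close> bounded_type_itm_axioms
    by (simp add: bounded_invariant_distribution_def)
  show ?thesis
    unfolding weakly_mixing_def
  proof (intro allI impI; (elim conjE)?)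
    fix f :: "real \<Rightarrow> complex" and c
    assume f: "f \<in> borel_measurable \<mu>" and sq: "integrable \<mu> (\<lambda>x. (cmod (f x))\<^sup>2)"
      and eig: "AE x in \<mu>. f (T x) = c * f x" and nz: "\<not> (AE x in \<mu>. f x = 0)"
    \<comment> \<open>\<open>f\<close> is measurable only with respect to the trace on the
      attractor; extension by 0 makes it Borel on the line.\<close>
    define g where "g x = indicator \<Omega> x *\<^sub>R f x" for x
    have g [measurable]: "g \<in> borel_measurable borel"
      using f unfolding measurable_cong_sets[OF sets refl] g_def[abs_def]
      by (subst (asm) borel_measurable_restrict_space_iff) auto
    have gf: "g x = f x" if "x \<in> space \<mu>" for x using that by (simp add: g_def space)
    have "c = 1 \<and> (\<exists>z. AE x in M. g x = z)"
    proof (rule eigenfunction_trivial[OF g])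
      have "integrable \<mu> (\<lambda>x. (cmod (g x))\<^sup>2)"
        using sq gf by (subst Bochner_Integration.integrable_cong[OF refl]) auto
      then show "integrable M (\<lambda>x. (cmod (g x))\<^sup>2)" unfolding M_def by (subst integrable_distr_eq) auto
      have "AE x in \<mu>. g (T x) = c * g x"
        using eig AE_space
      proof eventually_elim
        case (elim x)
        then have "T x \<in> space \<mu>" using measurable_space[OF meas] by blast
        then show ?case using elim gf by simp
      qed
      then show "AE x in M. g (T x) = c * g x" by (subst AE_M) auto
      have "\<not> (AE x in \<mu>. g x = 0)"
        using nz gf by (subst AE_cong[where Q = "\<lambda>x. f x = 0"]) auto
      then show "\<not> (AE x in M. g x = 0)" by (subst AE_M) auto
    qed
    then obtain z where "c = 1" "AE x in M. g x = z" by blast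
    then have "AE x in \<mu>. g x = z" by (subst (asm) AE_M) auto
    then have "AE x in \<mu>. f x = z" using AE_space by eventually_elim (simp add: gf)
    then show "c = 1 \<and> (\<exists>z. AE x in \<mu>. f x = z)" using \<open>c = 1\<close> by blast
  qed
qed

end

section \<open>Uniform bounds from eventual periodicity\<close>

lemma eventually_periodic_bounded:
  assumes "eventually_periodic k"
  shows "\<exists>K. \<forall>i. k i \<le> K"
proof -
  obtain p N where p: "0 < p" "\<And>i. N \<le> i \<Longrightarrow> k (i + p) = k i"
    using assms by (auto simp: eventually_periodic_def)
  have "k i \<le> Max (k ` {..N + p})" for i
  proof (induction i rule: less_induct)
    case (less i)
    show ?case
    proof (cases "i \<le> N + p")
      case False
      then have "k i = k (i - p)" using p(2)[of "i - p"] by simp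
      then show ?thesis using less[of "i - p"] False p(1) by simp
    qed simp
  qed
  then show ?thesis by blast
qed

lemma eventually_periodic_gap:
  assumes "eventually_periodic k"
    and even: "infinite {i. i \<ge> 1 \<and> k (2 * i) > 1}"
    and odd: "infinite {i. i \<ge> 1 \<and> k (2 * i - 1) > 1}"
  shows "\<exists>G. \<forall>n. \<exists>j\<le>G. 2 \<le> k (n + 2 * j)"
proof -
  obtain p N where p: "0 < p" "\<And>i. N \<le> i \<Longrightarrow> k (i + p) = k i"
    using assms by (auto simp: eventually_periodic_def)
  have per: "k (i + s * p) = k i" if "N \<le> i" for i s
    using that
  proof (induction s)
    case (Suc s)
    then show ?case using p(2)[of "i + s * p"] by (simp add: algebra_simps)
  qed simp
  have "\<exists>j\<le>N + p. 2 \<le> k (n + 2 * j)" for n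
  proof -
    \<comment> \<open>Adding \<open>2 * N\<close> passes the preperiod without changing the
      parity.\<close>
    define m where "m = n + 2 * N"
    have "\<exists>t. 2 \<le> k (m + 2 * t)"
    proof (cases "even m")
      case True
      obtain i where "m \<le> i" "k (2 * i) > 1" using even unfolding infinite_nat_iff_unbounded_le by blast
      then have "m + 2 * (i - m div 2) = 2 * i" using True by auto
      then show ?thesis using \<open>k (2 * i) > 1\<close> by (intro exI[of _ "i - m div 2"]) simp
    next
      case False
      obtain i where i: "Suc m \<le> i" "k (2 * i - 1) > 1" using odd unfolding infinite_nat_iff_unbounded_le by blast
      obtain l where l: "m = 2 * l + 1" using False by (auto elim!: oddE)
      have "m + 2 * (i - l - 1) = 2 * i - 1" using i l by simp
      then show ?thesis using i by (intro exI[of _ "i - l - 1"]) simp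
    qed
    then obtain t where t: "2 \<le> k (m + 2 * t)" by blast
    obtain q u where tq: "t = q * p + u" "u < p"
      using div_mult_mod_eq[of t p, symmetric] mod_less_divisor[OF p(1)] by blast
    \<comment> \<open>Reducing \<open>t\<close> modulo \<open>p\<close> moves the index by an even
      multiple of the period, so the digit and the parity survive and the remainder \<open>u\<close>
      bounds the gap.\<close>
    have "m + 2 * t = (m + 2 * u) + (2 * q) * p" unfolding tq(1) by simp
    then have "k (m + 2 * t) = k ((m + 2 * u) + (2 * q) * p)" by (simp only:)
    also have "\<dots> = k (m + 2 * u)" by (rule per) (simp add: m_def)
    finally have "k (m + 2 * t) = k (m + 2 * u)" .
    then have "2 \<le> k (n + 2 * (N + u))" using t by (simp add: m_def algebra_simps)
    then show ?thesis using p(1) by (intro exI[of _ "N + u"]) (use tq(2) in simp)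
  qed
  then show ?thesis by blast
qed

theorem theorem3p2:
  fixes k :: "nat \<Rightarrow> nat" and \<alpha> \<beta> :: real
  assumes "eventually_periodic k"
    and "infinite {i. i \<ge> 1 \<and> k (2 * i) > 1}"
    and "infinite {i. i \<ge> 1 \<and> k (2 * i - 1) > 1}"
    and "infinite_type \<alpha> \<beta>"
    and "\<forall>i\<ge>1. coding \<alpha> \<beta> i = k i"
  shows "(\<exists>\<mu>. invariant_prob \<alpha> \<beta> \<mu>) \<and>
         (\<forall>\<mu>. invariant_prob \<alpha> \<beta> \<mu> \<longrightarrow> weakly_mixing (itm \<alpha> \<beta>) \<mu>)"
proof -
  obtain K where K: "\<And>i. k i \<le> K" using eventually_periodic_bounded[OF assms(1)] by blast
  obtain G where G: "\<And>n. \<exists>j\<le>G. 2 \<le> k (n + 2 * j)" using eventually_periodic_gap[OF assms(1-3)] by blast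
  interpret infinite_type_itm \<alpha> \<beta> by (rule infinite_type_itm.intro) (rule assms(4))
  \<comment> \<open>The shift by one exchanges the parities, which the bound \<open>G\<close>
    tolerates because it holds from every starting index.\<close>
  have digit: "digit n = k (n + 1)" for n
    using assms(5)[rule_format, of "n + 1"] by (simp add: coding_def digit_def a_def)
  interpret bounded_type_itm \<alpha> \<beta> K G
  proof
    show "digit n \<le> K" for n using K by (simp add: digit)
    show "\<exists>j\<le>G. 2 \<le> digit (n + 2 * j)" for n using G[of "n + 1"] by (simp add: digit)
  qed
  show ?thesis using exists_invariant_prob invariant_prob_weakly_mixing by blast
qed

end
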